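(* Let $\mu\in(0,1/2]$ and consider the planar circular restricted charged three-body problem with parameters $\mu,\beta_1,\beta_2$, where $\beta_1,\beta_2>0$, $(\beta_1-1)(\beta_2-1)<1$ and, with $\delta_i=\beta_i^{1/3}$, $\delta_1+1\ge\delta_2$, $\delta_2+1\ge\delta_1$, $\delta_1+\delta_2\ge1$. Let $\gamma\in[0,\pi]$ be the angle associated with $(\beta_1,\beta_2)$ and let $F(\mu,\gamma)=1-36\mu(1-\mu)\sin^2(\gamma)$. Then the corresponding triangular equilibrium solutions (when the three triangle inequalities are strict), as well as the corresponding collinear solution that is a limit of triangular ones (when one of them is an equality), satisfy: \begin{enumerate} \item If $F(\mu,\gamma)<0$, the equilibrium solutions are unstable in the Lyapunov sense. \item If $F(\mu,\gamma)=0$, the equilibrium solutions are linearly unstable. \item If $0<F(\mu,\gamma)<1$, the equilibrium solutions are linearly stable. \item If $F(\mu,\gamma)=1$, the equilibrium solutions are linearly unstable. \end{enumerate}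
   Context: The planar circular restricted charged three-body problem with parameters $\mu\in(0,1/2]$ and $\beta_1,\beta_2\in\mathbb{R}$, $(\beta_1-1)(\beta_2-1)<1$, is the Hamiltonian system $$\dot x=y+p_x,\qquad \dot y=-x+p_y,\qquad \dot p_x=V_x+p_y,\qquad \dot p_y=V_y-p_x,$$ with Hamiltonian $H=\frac12(p_x^2+p_y^2)+(yp_x-xp_y)-V$, where $$V=\frac{\beta_1(1-\mu)}{\rho_1}+\frac{\beta_2\mu}{\rho_2},\quad \rho_1=\sqrt{(x+\mu)^2+y^2},\quad \rho_2=\sqrt{(x-1+\mu)^2+y^2},$$ on $\rho_1,\rho_2\ne0$. Equilibria are the points $(x,y,-y,x)$ with $V_x+x=0$, $V_y+y=0$; such an equilibrium is triangular if $y\neq0$ and collinear if $y=0$. When the three triangle inequalities are strict, the triangular equilibria are the two points $(x,y)$ with $\rho_1=\delta_1=\beta_1^{1/3}$, $\rho_2=\delta_2=\beta_2^{1/3}$, $y\ne0$. When one of them is an equality, the unique point on the axis $y=0$ with $\rho_1=\delta_1$, $\rho_2=\delta_2$ is a collinear equilibrium, called the solution limit of the triangular ones; it is $(-\mu-\beta_1^{1/3},0)$ if $\delta_2-\delta_1=1$, and $(-\mu+\beta_1^{1/3},0)$ if $\delta_1+\delta_2=1$ or $\delta_1-\delta_2=1$. The angle $\gamma=\gamma_1+\gamma_2\in[0,\pi]$, where $\gamma_i$ is the angle between the side of length $\rho_i$ and the side of length $1$ (joining the primaries $(-\mu,0)$ and $(1-\mu,0)$) of the possibly degenerate triangle with sides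 $1,\rho_1,\rho_2$; equivalently, $\gamma\in[0,\pi]$ is determined by $\delta_1^2+\delta_2^2+2\delta_1\delta_2\cos(\gamma)=1$. An equilibrium is linearly stable (respectively linearly unstable) if the origin is a stable (respectively unstable) equilibrium of the linearized system $\dot z=Az$, where $A$ is the $4\times4$ matrix of the linearization of the Hamiltonian system at the equilibrium. *)

theory Defs
  imports "HOL-Analysis.Analysis"
begin

definition solution_on ::
    "('a::real_normed_vector \<Rightarrow> 'a) \<Rightarrow> 'a set \<Rightarrow> real set \<Rightarrow> (real \<Rightarrow> 'a) \<Rightarrow> bool" where
  "solution_on X U I z \<longleftrightarrow>
     (\<forall>t\<in>I. z t \<in> U \<and> (z has_vector_derivative X (z t)) (at t within I))"

definition equilibrium :: "('a::real_normed_vector \<Rightarrow> 'a) \<Rightarrow> 'a set \<Rightarrow> 'a \<Rightarrow> bool" where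
  "equilibrium X U p \<longleftrightarrow> p \<in> U \<and> X p = 0"

text \<open>Lyapunov stability: solutions starting near the equilibrium exist for all forward time and
  remain near it. The second conjunct ranges over all solutions on compact intervals, so that no
  uniqueness theorem is built into the definition.\<close>

definition lyapunov_stable :: "('a::real_normed_vector \<Rightarrow> 'a) \<Rightarrow> 'a set \<Rightarrow> 'a \<Rightarrow> bool" where
  "lyapunov_stable X U p \<longleftrightarrow> equilibrium X U p \<and>
     (\<forall>\<epsilon>>0. \<exists>\<delta>>0. \<forall>q\<in>U. dist q p < \<delta> \<longrightarrow>
        (\<exists>z. solution_on X U {0..} z \<and> z 0 = q) \<and>
        (\<forall>T\<ge>0. \<forall>z. solution_on X U {0..T} z \<and> z 0 = q \<longrightarrow> (\<forall>t\<in>{0..T}. dist (z t) p < \<epsilon>)))"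

definition lyapunov_unstable :: "('a::real_normed_vector \<Rightarrow> 'a) \<Rightarrow> 'a set \<Rightarrow> 'a \<Rightarrow> bool" where
  "lyapunov_unstable X U p \<longleftrightarrow> equilibrium X U p \<and> \<not> lyapunov_stable X U p"

definition linearized :: "(real^'n \<Rightarrow> real^'n) \<Rightarrow> real^'n \<Rightarrow> real^'n \<Rightarrow> real^'n" where
  "linearized X p = (\<lambda>v. jacobian X (at p) *v v)"

definition linearly_stable :: "(real^'n \<Rightarrow> real^'n) \<Rightarrow> (real^'n) set \<Rightarrow> real^'n \<Rightarrow> bool" where
  "linearly_stable X U p \<longleftrightarrow> equilibrium X U p \<and> lyapunov_stable (linearized X p) UNIV 0"

definition linearly_unstable :: "(real^'n \<Rightarrow> real^'n) \<Rightarrow> (real^'n) set \<Rightarrow> real^'n \<Rightarrow> bool" where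
  "linearly_unstable X U p \<longleftrightarrow> equilibrium X U p \<and> lyapunov_unstable (linearized X p) UNIV 0"

definition rho1 :: "real \<Rightarrow> real \<Rightarrow> real \<Rightarrow> real" where
  "rho1 \<mu> x y = sqrt ((x + \<mu>)\<^sup>2 + y\<^sup>2)"

definition rho2 :: "real \<Rightarrow> real \<Rightarrow> real \<Rightarrow> real" where
  "rho2 \<mu> x y = sqrt ((x - 1 + \<mu>)\<^sup>2 + y\<^sup>2)"

definition potV :: "real \<Rightarrow> real \<Rightarrow> real \<Rightarrow> real \<Rightarrow> real \<Rightarrow> real" where
  "potV \<mu> \<beta>\<^sub>1 \<beta>\<^sub>2 x y = \<beta>\<^sub>1 * (1 - \<mu>) / rho1 \<mu> x y + \<beta>\<^sub>2 * \<mu> / rho2 \<mu> x y"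

definition potV_x :: "real \<Rightarrow> real \<Rightarrow> real \<Rightarrow> real \<Rightarrow> real \<Rightarrow> real" where
  "potV_x \<mu> \<beta>\<^sub>1 \<beta>\<^sub>2 x y = deriv (\<lambda>s. potV \<mu> \<beta>\<^sub>1 \<beta>\<^sub>2 s y) x"

definition potV_y :: "real \<Rightarrow> real \<Rightarrow> real \<Rightarrow> real \<Rightarrow> real \<Rightarrow> real" where
  "potV_y \<mu> \<beta>\<^sub>1 \<beta>\<^sub>2 x y = deriv (\<lambda>s. potV \<mu> \<beta>\<^sub>1 \<beta>\<^sub>2 x s) y"

text \<open>A phase point is the vector of coordinates $(x, y, p_x, p_y)$.\<close>

definition phase_space :: "real \<Rightarrow> (real^4) set" where
  "phase_space \<mu> = {z. rho1 \<mu> (z$1) (z$2) \<noteq> 0 \<and> rho2 \<mu> (z$1) (z$2) \<noteq> 0}"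

text \<open>These are Hamilton's equations of
  $H = \frac12(p_x^2 + p_y^2) + (y p_x - x p_y) - V$.\<close>

definition charged_field :: "real \<Rightarrow> real \<Rightarrow> real \<Rightarrow> real^4 \<Rightarrow> real^4" where
  "charged_field \<mu> \<beta>\<^sub>1 \<beta>\<^sub>2 z = vector
     [z$2 + z$3,
      - z$1 + z$4,
      potV_x \<mu> \<beta>\<^sub>1 \<beta>\<^sub>2 (z$1) (z$2) + z$4,
      potV_y \<mu> \<beta>\<^sub>1 \<beta>\<^sub>2 (z$1) (z$2) - z$3]"

definition triangular_equilibrium :: "real \<Rightarrow> real \<Rightarrow> real \<Rightarrow> real^4 \<Rightarrow> bool" where
  "triangular_equilibrium \<mu> \<beta>\<^sub>1 \<beta>\<^sub>2 z \<longleftrightarrow>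
     equilibrium (charged_field \<mu> \<beta>\<^sub>1 \<beta>\<^sub>2) (phase_space \<mu>) z \<and> z$2 \<noteq> 0"

text \<open>The phase point $(x, y, -y, x)$ over the point of the axis $y = 0$ at distances
  $\beta_1^{1/3}$, $\beta_2^{1/3}$ from the primaries. That it is an equilibrium is not part of
  the definition.\<close>

definition collinear_limit :: "real \<Rightarrow> real \<Rightarrow> real \<Rightarrow> real^4 \<Rightarrow> bool" where
  "collinear_limit \<mu> \<beta>\<^sub>1 \<beta>\<^sub>2 z \<longleftrightarrow>
     (\<exists>x. z = vector [x, 0, 0, x] \<and> rho1 \<mu> x 0 = root 3 \<beta>\<^sub>1 \<and> rho2 \<mu> x 0 = root 3 \<beta>\<^sub>2)"

lemma collinear_limit_iff:
  assumes \<beta>: "\<beta>\<^sub>1 > 0" "\<beta>\<^sub>2 > 0"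
  shows "root 3 \<beta>\<^sub>2 - root 3 \<beta>\<^sub>1 = 1 \<Longrightarrow> collinear_limit \<mu> \<beta>\<^sub>1 \<beta>\<^sub>2 z \<longleftrightarrow>
           z = vector [- \<mu> - root 3 \<beta>\<^sub>1, 0, 0, - \<mu> - root 3 \<beta>\<^sub>1]"
    and "root 3 \<beta>\<^sub>1 + root 3 \<beta>\<^sub>2 = 1 \<or> root 3 \<beta>\<^sub>1 - root 3 \<beta>\<^sub>2 = 1 \<Longrightarrow>
           collinear_limit \<mu> \<beta>\<^sub>1 \<beta>\<^sub>2 z \<longleftrightarrow>
           z = vector [- \<mu> + root 3 \<beta>\<^sub>1, 0, 0, - \<mu> + root 3 \<beta>\<^sub>1]"
proof -
  define a b where ab: "a = root 3 \<beta>\<^sub>1" "b = root 3 \<beta>\<^sub>2"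
  have pos: "a > 0" "b > 0" using \<beta> by (simp_all add: ab)
  have r: "rho1 \<mu> x 0 = \<bar>x + \<mu>\<bar>" "rho2 \<mu> x 0 = \<bar>x - 1 + \<mu>\<bar>" for x
    by (simp_all add: rho1_def rho2_def)
  {
    assume "b - a = 1"
    then have "\<bar>x + \<mu>\<bar> = a \<and> \<bar>x - 1 + \<mu>\<bar> = b \<longleftrightarrow> x = - \<mu> - a" for x
      using pos by linarith
    then show "collinear_limit \<mu> \<beta>\<^sub>1 \<beta>\<^sub>2 z \<longleftrightarrow> z = vector [- \<mu> - a, 0, 0, - \<mu> - a]"
      unfolding collinear_limit_def r ab[symmetric] by metis
  }
  {
    assume "a + b = 1 \<or> a - b = 1"
    then have "\<bar>x + \<mu>\<bar> = a \<and> \<bar>x - 1 + \<mu>\<bar> = b \<longleftrightarrow> x = - \<mu> + a" for x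
      using pos by linarith
    then show "collinear_limit \<mu> \<beta>\<^sub>1 \<beta>\<^sub>2 z \<longleftrightarrow> z = vector [- \<mu> + a, 0, 0, - \<mu> + a]"
      unfolding collinear_limit_def r ab[symmetric] by metis
  }
qed

text \<open>The angle between the sides of lengths \<open>a\<close> and \<open>b\<close> of the (possibly degenerate) triangle
  with side lengths \<open>a\<close>, \<open>b\<close>, \<open>c\<close>, given by the law of cosines.\<close>

definition triangle_angle :: "real \<Rightarrow> real \<Rightarrow> real \<Rightarrow> real" where
  "triangle_angle a b c = arccos ((a\<^sup>2 + b\<^sup>2 - c\<^sup>2) / (2 * a * b))"

definition gamma_angle :: "real \<Rightarrow> real \<Rightarrow> real" where
  "gamma_angle \<delta>\<^sub>1 \<delta>\<^sub>2 = triangle_angle \<delta>\<^sub>1 1 \<delta>\<^sub>2 + triangle_angle \<delta>\<^sub>2 1 \<delta>\<^sub>1"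

lemma gamma_angle:
  assumes d: "\<delta>\<^sub>1 > 0" "\<delta>\<^sub>2 > 0"
    and tri: "\<delta>\<^sub>1 + 1 \<ge> \<delta>\<^sub>2" "\<delta>\<^sub>2 + 1 \<ge> \<delta>\<^sub>1" "\<delta>\<^sub>1 + \<delta>\<^sub>2 \<ge> 1"
  shows "gamma_angle \<delta>\<^sub>1 \<delta>\<^sub>2 \<in> {0..pi}"
    and "\<delta>\<^sub>1\<^sup>2 + \<delta>\<^sub>2\<^sup>2 + 2 * \<delta>\<^sub>1 * \<delta>\<^sub>2 * cos (gamma_angle \<delta>\<^sub>1 \<delta>\<^sub>2) = 1"
proof -
  define a b where ab: "a = \<delta>\<^sub>1" "b = \<delta>\<^sub>2"
  define u v where u: "u = (a\<^sup>2 + 1 - b\<^sup>2) / (2 * a)" and v: "v = (b\<^sup>2 + 1 - a\<^sup>2) / (2 * b)"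
  have pos: "a > 0" "b > 0" using d by (simp_all add: ab)
  have sq: "b\<^sup>2 \<le> (a + 1)\<^sup>2" "a\<^sup>2 \<le> (b + 1)\<^sup>2" "(1 - a)\<^sup>2 \<le> b\<^sup>2" "(1 - b)\<^sup>2 \<le> a\<^sup>2"
    using tri pos by (auto simp: ab abs_le_square_iff[symmetric])
  have ub: "- 1 \<le> u" "u \<le> 1" "- 1 \<le> v" "v \<le> 1"
    using sq pos by (simp_all add: u v field_simps power2_eq_square)
  define S where "S = 4 * a\<^sup>2 * (1 - u\<^sup>2)"
  have Su: "1 - u\<^sup>2 = S / (2 * a)\<^sup>2"
    using pos by (simp add: S_def power2_eq_square)
  have au: "2 * a * u = a\<^sup>2 + 1 - b\<^sup>2" and bv: "2 * b * v = b\<^sup>2 + 1 - a\<^sup>2"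
    using pos by (simp_all add: u v)
  have "4 * a\<^sup>2 - (2 * a * u)\<^sup>2 = 4 * b\<^sup>2 - (2 * b * v)\<^sup>2"
    unfolding au bv by (simp add: power2_eq_square algebra_simps)
  then have "S = 4 * b\<^sup>2 * (1 - v\<^sup>2)"
    by (simp add: S_def power_mult_distrib algebra_simps)
  then have Sv: "1 - v\<^sup>2 = S / (2 * b)\<^sup>2"
    using pos by (simp add: power2_eq_square)
  have S0: "S \<ge> 0"
    using ub pos by (simp add: S_def abs_square_le_1)
  have g: "gamma_angle \<delta>\<^sub>1 \<delta>\<^sub>2 = arccos u + arccos v"
    by (simp add: gamma_angle_def triangle_angle_def u v ab)
  have "cos (arccos u + arccos v) = u * v - sqrt (1 - u\<^sup>2) * sqrt (1 - v\<^sup>2)"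
    using ub by (simp add: cos_add cos_arccos sin_arccos)
  also have "sqrt (1 - u\<^sup>2) * sqrt (1 - v\<^sup>2) = S / (4 * a * b)"
    unfolding Su Sv using pos S0 by (simp add: real_sqrt_divide real_sqrt_mult)
  finally have "2 * a * b * cos (arccos u + arccos v) = 2 * a * b * u * v - S / 2"
    using pos by (simp add: field_simps)
  also have "\<dots> = (2 * a * u) * (2 * b * v) / 2 - (4 * a\<^sup>2 - (2 * a * u)\<^sup>2) / 2"
    by (simp add: S_def power_mult_distrib algebra_simps)
  also have "\<dots> = 1 - a\<^sup>2 - b\<^sup>2"
    unfolding au bv by (simp add: power2_eq_square field_simps)
  finally show "\<delta>\<^sub>1\<^sup>2 + \<delta>\<^sub>2\<^sup>2 + 2 * \<delta>\<^sub>1 * \<delta>\<^sub>2 * cos (gamma_angle \<delta>\<^sub>1 \<delta>\<^sub>2) = 1"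
    by (simp add: g ab)
  have "u + v \<ge> 0"
  proof -
    have "2 * a * b * (u + v) = b * (2 * a * u) + a * (2 * b * v)"
      by (simp add: algebra_simps)
    also have "\<dots> = (a + b) * (1 - (a - b)\<^sup>2)"
      unfolding au bv by (simp add: power2_eq_square algebra_simps)
    also have "\<dots> \<ge> 0"
      using tri pos by (intro mult_nonneg_nonneg) (auto simp: ab abs_square_le_1)
    finally have "0 \<le> (2 * a * b) * (u + v)" .
    moreover have "2 * a * b > 0"
      using pos by simp
    ultimately show ?thesis
      by (metis zero_le_mult_iff not_less)
  qed
  then have "arccos u \<le> arccos (- v)"
    using ub by (intro arccos_le_arccos) auto
  then have "arccos u + arccos v \<le> pi"
    using ub by (simp add: arccos_minus)
  then show "gamma_angle \<delta>\<^sub>1 \<delta>\<^sub>2 \<in> {0..pi}"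
    using ub by (simp add: g arccos_lbound)
qed

definition stability_F :: "real \<Rightarrow> real \<Rightarrow> real" where
  "stability_F \<mu> \<gamma> = 1 - 36 * \<mu> * (1 - \<mu>) * (sin \<gamma>)\<^sup>2"

end

theory Submission
  imports Defs
begin

text \<open>
  At a point at distances \<open>\<delta>\<^sub>i = root 3 \<beta>\<^sub>i\<close> from the primaries, the effective force vanishes and the
  effective potential has the Hessian \<open>3 (1 - \<mu>) e\<^sub>1 e\<^sub>1\<^sup>T + 3 \<mu> e\<^sub>2 e\<^sub>2\<^sup>T\<close>, where \<open>e\<^sub>i\<close> is the unit vector from
  the primary to the point. Its trace is \<open>3\<close>, and its determinant is \<open>9 \<mu> (1 - \<mu>)\<close> times the squared
  cross product of \<open>e\<^sub>1\<close> and \<open>e\<^sub>2\<close>, which is \<open>(sin \<gamma>)^2\<close>. Therefore the linearization \<open>L\<close> satisfies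
  \<open>L^4 + L^2 + k = 0\<close> with \<open>k = 9 \<mu> (1 - \<mu>) (sin \<gamma>)^2\<close>
  (\<open>charged_field_has_derivative\<close>, \<open>hessian_field_characteristic\<close>, \<open>sin_gamma_angle\<close>), and
  \<open>stability_F \<mu> \<gamma> = 1 - 4 k\<close> is the discriminant of the quadratic polynomial in \<open>\<lambda>^2\<close>. This covers the
  triangular points and their collinear limit at once.

  The four cases are the possible root patterns. For \<open>k > 1 / 4\<close> the eigenvalues form a complex quadruple
  with real parts \<open>\<plusminus> s / 2 \<noteq> 0\<close>, and instability passes to the nonlinear system
  (\<open>lyapunov_unstable_if_complex_quadruple\<close>). For \<open>k = 1 / 4\<close> there is a double pair of imaginary
  eigenvalues, for \<open>k = 0\<close> a double eigenvalue zero, and the Coriolis coupling makes the Jordan blocks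
  nontrivial, so that solutions of the linear system grow linearly
  (\<open>lyapunov_unstable_if_imaginary_jordan_block\<close>, \<open>lyapunov_unstable_if_zero_jordan_block\<close>). For
  \<open>0 < k < 1 / 4\<close> there are two distinct frequencies and the linear motion is a sum of two harmonic
  oscillations (\<open>lyapunov_stable_if_two_frequencies\<close>).

  Instead of Jordan forms, all arguments use polynomials in \<open>L\<close> as projections onto spectral
  parts, and energies of these parts as quadratic functions whose evolution along any solution is known.
\<close>

section \<open>Instability by escape\<close>

lemma increment_ge_if_derivative_ge:
  fixes g D :: "real \<Rightarrow> real"
  assumes "0 \<le> T" and g: "\<And>t. t \<in> {0..T} \<Longrightarrow> (g has_vector_derivative D t) (at t within {0..T})"
    and D: "\<And>t. t \<in> {0..T} \<Longrightarrow> m \<le> D t"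
  shows "g 0 + m * T \<le> g T"
proof -
  have "\<exists>t\<in>{0..T}. g T - g 0 = (\<lambda>h. h *\<^sub>R D t) (T - 0)"
    using assms(1) g by (intro mvt_very_simple) (auto simp: has_vector_derivative_def)
  then obtain t where "t \<in> {0..T}" "g T - g 0 = T * D t" by auto
  with D[of t] \<open>0 \<le> T\<close> mult_left_mono[of m "D t" T] show ?thesis by (simp add: mult.commute)
qed

text \<open>Stability hands out, for every start close to \<open>p\<close>, a solution for all forward time that stays in
the ball on which \<open>G\<close> is bounded; linear growth of \<open>G\<close> along it is then absurd. Because
the solution comes from the assumed stability, an instability proof never has to construct one, and
the growth need only be checked for solutions that have not yet left the ball.\<close>

lemma lyapunov_unstable_if_escaping:
  fixes X :: "'a::real_normed_vector \<Rightarrow> 'a" and G :: "'a \<Rightarrow> real"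
  assumes eq: "equilibrium X U p" and "e > 0"
    and bound: "\<And>x. dist x p < e \<Longrightarrow> \<bar>G x\<bar> \<le> M"
    and grow: "\<And>d. d > 0 \<Longrightarrow> \<exists>q\<in>U. dist q p < d \<and> (\<exists>m>0. \<forall>z T. T \<ge> 0 \<longrightarrow>
        solution_on X U {0..T} z \<longrightarrow> z 0 = q \<longrightarrow> (\<forall>t\<in>{0..T}. dist (z t) p < e) \<longrightarrow>
        G q + m * T \<le> G (z T))"
  shows "lyapunov_unstable X U p"
proof -
  have False if "lyapunov_stable X U p"
  proof -
    have "\<forall>\<epsilon>>0. \<exists>\<delta>>0. \<forall>q\<in>U. dist q p < \<delta> \<longrightarrow> (\<exists>z. solution_on X U {0..} z \<and> z 0 = q) \<and>
        (\<forall>T\<ge>0. \<forall>z. solution_on X U {0..T} z \<and> z 0 = q \<longrightarrow> (\<forall>t\<in>{0..T}. dist (z t) p < \<epsilon>))"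
      using that unfolding lyapunov_stable_def by (rule conjunct2)
    from this[rule_format, OF \<open>e > 0\<close>] obtain d where "d > 0" and
      d: "\<forall>q\<in>U. dist q p < d \<longrightarrow> (\<exists>z. solution_on X U {0..} z \<and> z 0 = q) \<and>
        (\<forall>T\<ge>0. \<forall>z. solution_on X U {0..T} z \<and> z 0 = q \<longrightarrow> (\<forall>t\<in>{0..T}. dist (z t) p < e))"
      by (elim exE conjE)
    from grow[OF \<open>d > 0\<close>] obtain q m where q: "q \<in> U" "dist q p < d" and "m > 0" and
      m: "\<forall>z T. T \<ge> 0 \<longrightarrow> solution_on X U {0..T} z \<longrightarrow> z 0 = q \<longrightarrow>
        (\<forall>t\<in>{0..T}. dist (z t) p < e) \<longrightarrow> G q + m * T \<le> G (z T)"
      by (elim bexE exE conjE) (rule that; assumption)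
    note dq = d[rule_format, OF q]
    obtain z where z: "solution_on X U {0..} z" "z 0 = q" using conjunct1[OF dq] by (elim conjE exE)
    \<comment> \<open>\<open>G\<close> varies by at most \<open>2 * \<bar>M\<bar>\<close> in the ball; at this time it has grown by more.\<close>
    define T where "T = (2 * \<bar>M\<bar> + 1) / m"
    have "T \<ge> 0" using \<open>m > 0\<close> by (simp add: T_def)
    have zT: "solution_on X U {0..T} z"
      using z(1) unfolding solution_on_def
      by (auto intro: has_vector_derivative_within_subset[of z _ _ "{0..}"])
    have near: "\<forall>t\<in>{0..T}. dist (z t) p < e"
      using conjunct2[OF dq] zT z(2) \<open>T \<ge> 0\<close> by simp
    have "G q + m * T \<le> G (z T)" using m \<open>T \<ge> 0\<close> zT z(2) near by simp
    moreover have "\<bar>G q\<bar> \<le> M" "\<bar>G (z T)\<bar> \<le> M"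
      using near z(2) \<open>T \<ge> 0\<close> by (auto intro!: bound)
    moreover have "m * T = 2 * \<bar>M\<bar> + 1" using \<open>m > 0\<close> by (simp add: T_def)
    ultimately show False by linarith
  qed
  then show ?thesis using eq by (auto simp: lyapunov_unstable_def)
qed

lemma bilinear_along_solution:
  fixes Q :: "'a::euclidean_space \<Rightarrow> 'a \<Rightarrow> real"
  assumes "bilinear Q" and z: "(z has_vector_derivative v) (at t within S)"
  shows "((\<lambda>s. Q (z s - p) (z s - p)) has_vector_derivative Q (z t - p) v + Q v (z t - p)) (at t within S)"
proof -
  interpret Q: bounded_bilinear Q
    using assms(1) by (simp add: bilinear_conv_bounded_bilinear)
  have "((\<lambda>s. z s - p) has_vector_derivative v) (at t within S)"
    using has_vector_derivative_diff[OF z has_vector_derivative_const[of p]] by simp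
  from Q.has_vector_derivative[OF this this] show ?thesis .
qed

text \<open>The use is for double eigenvalues on the imaginary axis, where solutions grow polynomially and no
coercive form exists: \<open>Q\<close> then grows at a rate \<open>R\<close> that is a first integral.\<close>

lemma lyapunov_unstable_if_quadratic_growth:
  fixes A :: "'a::euclidean_space \<Rightarrow> 'a"
  assumes A: "linear A" and Q: "bilinear Q" and R: "bilinear R"
    and growth: "\<And>h. Q h (A h) + Q (A h) h = (R h h :: real)"
    and conserved: "\<And>h. R h (A h) + R (A h) h = 0"
    and pos: "R v v > 0"
  shows "lyapunov_unstable A UNIV 0"
proof -
  obtain K where "K > 0" and K: "\<And>x y. \<bar>Q x y\<bar> \<le> K * norm x * norm y"
    using bilinear_bounded_pos[OF Q] by auto
  have along: "((\<lambda>s. B (z s) (z s)) has_vector_derivative B (z t) (A (z t)) + B (A (z t)) (z t)) (at t within {0..T})"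
    if "bilinear B" "solution_on A UNIV {0..T} z" "t \<in> {0..T}" for B :: "'a \<Rightarrow> 'a \<Rightarrow> real" and z t T
    using bilinear_along_solution[of B z _ t "{0..T}" 0] that by (auto simp: solution_on_def)
  show ?thesis
  proof (rule lyapunov_unstable_if_escaping[where e = 1 and M = K and G = "\<lambda>x. Q x x"])
    show "equilibrium A UNIV 0" using linear_0[OF A] by (simp add: equilibrium_def)
    fix x :: 'a assume "dist x 0 < 1"
    then have "norm x * norm x \<le> 1 * 1" by (intro mult_mono) auto
    then have "K * (norm x * norm x) \<le> K * 1" using \<open>K > 0\<close> by (intro mult_left_mono) auto
    with K[of x x] show "\<bar>Q x x\<bar> \<le> K" by (simp add: mult.assoc)
  next
    fix d :: real assume "d > 0"
    define r where "r = d / (2 * norm v)"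
    have "v \<noteq> 0" using pos bilinear_lzero[OF R] by auto
    then have "r > 0" "dist (r *\<^sub>R v) 0 < d" using \<open>d > 0\<close> by (simp_all add: r_def)
    moreover have "Q (r *\<^sub>R v) (r *\<^sub>R v) + R (r *\<^sub>R v) (r *\<^sub>R v) * T \<le> Q (z T) (z T)"
      if "T \<ge> 0" and z: "solution_on A UNIV {0..T} z" "z 0 = r *\<^sub>R v" for z T
    proof -
      have R0: "R (z 0) (z 0) \<le> R (z t) (z t)" if t: "t \<in> {0..T}" for t
      proof -
        have zt: "solution_on A UNIV {0..t} z"
          using z(1) t unfolding solution_on_def
          by (auto intro: has_vector_derivative_within_subset[of z _ _ "{0..T}"])
        show ?thesis
          using increment_ge_if_derivative_ge[of t _ "\<lambda>_. 0" 0, OF _ along[OF R zt, unfolded conserved]] t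
          by simp
      qed
      show ?thesis
        unfolding z(2)[symmetric] using R0
        by (intro increment_ge_if_derivative_ge[OF \<open>T \<ge> 0\<close> along[OF Q z(1), unfolded growth]]) auto
    qed
    moreover have "R (r *\<^sub>R v) (r *\<^sub>R v) > 0"
      using \<open>r > 0\<close> pos by (simp add: bilinear_lmul[OF R] bilinear_rmul[OF R])
    ultimately show "\<exists>q\<in>UNIV. dist q 0 < d \<and> (\<exists>m>0. \<forall>z T. T \<ge> 0 \<longrightarrow>
        solution_on A UNIV {0..T} z \<longrightarrow> z 0 = q \<longrightarrow> (\<forall>t\<in>{0..T}. dist (z t) 0 < 1) \<longrightarrow>
        Q q q + m * T \<le> Q (z T) (z T))"
      by (intro bexI[of _ "r *\<^sub>R v"] conjI exI[of _ "R (r *\<^sub>R v) (r *\<^sub>R v)"] allI impI UNIV_I)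
  qed simp
qed

section \<open>Instability from Jordan blocks on the imaginary axis\<close>

text \<open>With \<open>y = N z\<close> the velocity \<open>A y\<close> of \<open>y\<close> is constant along a solution, so
\<open>y \<bullet> A y\<close> grows at the constant rate \<open>A y \<bullet> A y\<close>.\<close>

lemma lyapunov_unstable_if_zero_jordan_block:
  fixes A N :: "'a::euclidean_space \<Rightarrow> 'a"
  assumes A: "linear A" and N: "linear N"
    and comm: "\<And>x. N (A x) = A (N x)" and nil: "\<And>x. A (A (N x)) = 0"
    and "A (N v) \<noteq> 0"
  shows "lyapunov_unstable A UNIV 0"
proof (rule lyapunov_unstable_if_quadratic_growth[OF A,
      where Q = "\<lambda>x y. N x \<bullet> A (N y)" and R = "\<lambda>x y. A (N x) \<bullet> A (N y)" and v = v])
  show "bilinear (\<lambda>x y. N x \<bullet> A (N y))" "bilinear (\<lambda>x y. A (N x) \<bullet> A (N y))"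
    unfolding bilinear_def linear_iff
    by (simp_all only: linear_add[OF A] linear_add[OF N] linear_scale[OF A] linear_scale[OF N] inner_simps)
      simp_all
  show "A (N v) \<bullet> A (N v) > 0" using \<open>A (N v) \<noteq> 0\<close> by simp
qed (simp_all add: comm nil linear_0[OF A])

text \<open>A solution \<open>z\<close> is an oscillator of frequency \<open>sqrt a\<close> driven in resonance by \<open>N z\<close>, which is
itself a free oscillation of the same frequency. The energy
\<open>a * (N z \<bullet> N z) + A (N z) \<bullet> A (N z)\<close> of the drive is conserved, and a quadratic form that
couples \<open>z\<close> to its drive has exactly this energy as its derivative.\<close>

lemma lyapunov_unstable_if_imaginary_jordan_block:
  fixes A :: "'a::euclidean_space \<Rightarrow> 'a"
  assumes A: "linear A" and "a > 0"
    and N: "\<And>x. N x = A (A x) + a *\<^sub>R x"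
    and nil: "\<And>x. N (N x) = 0" and "N v \<noteq> 0"
  shows "lyapunov_unstable A UNIV 0"
proof -
  note lin = linear_add[OF A] linear_scale[OF A] linear_diff[OF A]
  have comm: "N (A x) = A (N x)" for x by (simp add: N lin)
  have "A (A (N x)) + a *\<^sub>R N x = 0" for x using nil[of x] by (simp add: N[of "N x"])
  then have AAN: "A (A (N x)) = - a *\<^sub>R N x" for x by (simp add: eq_neg_iff_add_eq_0)
  have AA: "A (A x) = N x - a *\<^sub>R x" for x by (simp add: N)
  have linN: "N (x + y) = N x + N y" "N (c *\<^sub>R x) = c *\<^sub>R N x" for x y c
    by (simp_all add: N lin algebra_simps)
  define Q where "Q x y = a * (2 * (A x \<bullet> N y) - x \<bullet> A (N y)) + A (A x) \<bullet> A (N y)" for x y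
  define R where "R x y = a * (N x \<bullet> N y) + A (N x) \<bullet> A (N y)" for x y
  show ?thesis
  proof (rule lyapunov_unstable_if_quadratic_growth[OF A])
    show "bilinear Q" unfolding Q_def bilinear_def linear_iff
      by (simp only: lin linN inner_simps) (simp add: algebra_simps)
    show "bilinear R" unfolding R_def bilinear_def linear_iff
      by (simp only: lin linN inner_simps) (simp add: algebra_simps)
    show "Q h (A h) + Q (A h) h = R h h" for h
      unfolding Q_def R_def comm AAN AA[of h] lin
      by (simp add: inner_diff_left algebra_simps)
    show "R h (A h) + R (A h) h = 0" for h
      by (simp add: R_def comm AAN inner_commute)
    show "R v v > 0"
      using \<open>N v \<noteq> 0\<close> \<open>a > 0\<close> by (simp add: R_def add_pos_nonneg)
  qed
qed

section \<open>Instability from a complex quadruple of eigenvalues\<close>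

text \<open>This is instability by the first approximation. The coercivity is a property of the linear part
\<open>A\<close> alone: near \<open>p\<close> the remainder changes the derivative of \<open>Q\<close> along a solution by at most half
of it. A solution that starts with \<open>Q > 0\<close> keeps at least its initial value of \<open>Q\<close>, hence keeps a
distance from \<open>p\<close>, hence \<open>Q\<close> grows at least linearly.\<close>

lemma lyapunov_unstable_if_chetaev_form:
  fixes X :: "'a::euclidean_space \<Rightarrow> 'a" and Q :: "'a \<Rightarrow> 'a \<Rightarrow> real"
  assumes "open U" and "p \<in> U" and "X p = 0" and X: "(X has_derivative A) (at p)"
    and Q: "bilinear Q" and "c > 0"
    and coercive: "\<And>h. c * (norm h)\<^sup>2 \<le> Q h (A h) + Q (A h) h"
    and pos: "Q v v > 0"
  shows "lyapunov_unstable X U p"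
proof -
  obtain K where "K > 0" and K: "\<And>x y. \<bar>Q x y\<bar> \<le> K * norm x * norm y"
    using bilinear_bounded_pos[OF Q] by auto
  \<comment> \<open>Half of the coercivity constant, shared by the two summands, each bounded by \<open>K\<close>.\<close>
  have "c / (4 * K) > 0" using \<open>c > 0\<close> \<open>K > 0\<close> by simp
  then obtain e where "e > 0" and
    e: "\<And>x. norm (x - p) < e \<Longrightarrow> norm (X x - A (x - p)) \<le> c / (4 * K) * norm (x - p)"
    using X \<open>X p = 0\<close> unfolding has_derivative_at_alt by auto
  have drift: "c / 2 * (norm (x - p))\<^sup>2 \<le> Q (x - p) (X x) + Q (X x) (x - p)" if "norm (x - p) < e" for x
  proof -
    define h g where "h = x - p" and "g = X x - A h"
    have g: "norm g \<le> c / (4 * K) * norm h" using e[OF that] by (simp add: h_def g_def)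
    have "\<bar>Q h g\<bar> \<le> K * norm h * (c / (4 * K) * norm h)"
      by (rule order_trans[OF K mult_left_mono[OF g]]) (use \<open>K > 0\<close> in simp)
    moreover have "\<bar>Q g h\<bar> \<le> K * (c / (4 * K) * norm h) * norm h"
      by (rule order_trans[OF K mult_right_mono[OF mult_left_mono[OF g]]]) (use \<open>K > 0\<close> in simp_all)
    moreover have "K * norm h * (c / (4 * K) * norm h) = c / 4 * (norm h)\<^sup>2"
      "K * (c / (4 * K) * norm h) * norm h = c / 4 * (norm h)\<^sup>2"
      using \<open>K > 0\<close> by (simp_all add: power2_eq_square)
    moreover have "X x = A h + g" by (simp add: g_def)
    then have "Q h (X x) + Q (X x) h = (Q h (A h) + Q (A h) h) + (Q h g + Q g h)"
      by (simp add: bilinear_ladd[OF Q] bilinear_radd[OF Q])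
    ultimately show ?thesis using coercive[of h] unfolding h_def[symmetric] by linarith
  qed
  show ?thesis
  proof (rule lyapunov_unstable_if_escaping[where e = e and M = "K * e * e" and G = "\<lambda>x. Q (x - p) (x - p)"])
    show "equilibrium X U p" using assms by (simp add: equilibrium_def)
    show "\<bar>Q (x - p) (x - p)\<bar> \<le> K * e * e" if "dist x p < e" for x
      using that \<open>K > 0\<close> \<open>e > 0\<close>
      by (intro order_trans[OF K] mult_mono mult_left_mono) (auto simp: dist_norm)
  next
    fix d :: real assume "d > 0"
    obtain \<rho> where "\<rho> > 0" and \<rho>: "ball p \<rho> \<subseteq> U"
      using \<open>open U\<close> \<open>p \<in> U\<close> open_contains_ball by blast
    have "v \<noteq> 0" using pos bilinear_lzero[OF Q] by auto
    define r where "r = min d \<rho> / (2 * norm v)"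
    define q where "q = p + r *\<^sub>R v"
    have "r > 0" using \<open>d > 0\<close> \<open>\<rho> > 0\<close> \<open>v \<noteq> 0\<close> by (simp add: r_def)
    have "dist q p = min d \<rho> / 2" using \<open>v \<noteq> 0\<close> \<open>d > 0\<close> \<open>\<rho> > 0\<close> by (simp add: q_def r_def dist_norm)
    then have dq: "dist q p < d" and "q \<in> U"
      using \<rho> \<open>d > 0\<close> \<open>\<rho> > 0\<close> by (auto simp: dist_commute subset_iff)
    define G where "G x = Q (x - p) (x - p)" for x
    have Gq: "G q > 0" using \<open>r > 0\<close> pos by (simp add: G_def q_def bilinear_lmul[OF Q] bilinear_rmul[OF Q])
    define m where "m = c / 2 * (G q / K)"
    have "m > 0" using Gq \<open>c > 0\<close> \<open>K > 0\<close> by (simp add: m_def)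
    have "G q + m * T \<le> G (z T)"
      if "T \<ge> 0" and z: "solution_on X U {0..T} z" "z 0 = q" and near: "\<forall>t\<in>{0..T}. dist (z t) p < e" for z T
    proof -
      define D where "D t = Q (z t - p) (X (z t)) + Q (X (z t)) (z t - p)" for t
      have along: "((\<lambda>s. G (z s)) has_vector_derivative D t) (at t within {0..S})"
        if "t \<in> {0..S}" "S \<le> T" for t S
        unfolding G_def D_def using z(1) that
        by (intro bilinear_along_solution[OF Q])
          (auto simp: solution_on_def intro: has_vector_derivative_within_subset[of z _ _ "{0..T}"])
      have D: "c / 2 * (norm (z t - p))\<^sup>2 \<le> D t" if "t \<in> {0..T}" for t
        unfolding D_def using near that by (intro drift) (auto simp: dist_norm)
      have D0: "0 \<le> D t" if "t \<in> {0..T}" for t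
        by (rule order_trans[OF _ D[OF that]]) (use \<open>c > 0\<close> in simp)
      have "m \<le> D t" if t: "t \<in> {0..T}" for t
      proof -
        have "G (z 0) + 0 * t \<le> G (z t)"
          using t by (intro increment_ge_if_derivative_ge[OF _ along] D0) auto
        also have "G (z t) \<le> K * (norm (z t - p))\<^sup>2"
          using K[of "z t - p" "z t - p"] by (simp add: G_def power2_eq_square mult.assoc)
        finally have "G q / K \<le> (norm (z t - p))\<^sup>2" using z(2) \<open>K > 0\<close> by (simp add: field_simps)
        then have "m \<le> c / 2 * (norm (z t - p))\<^sup>2"
          unfolding m_def using \<open>c > 0\<close> by (intro mult_left_mono) auto
        with D[OF t] show ?thesis by simp
      qed
      then show ?thesis
        unfolding z(2)[symmetric] using \<open>T \<ge> 0\<close>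
        by (intro increment_ge_if_derivative_ge[OF _ along]) auto
    qed
    then show "\<exists>q\<in>U. dist q p < d \<and> (\<exists>m>0. \<forall>z T. T \<ge> 0 \<longrightarrow> solution_on X U {0..T} z \<longrightarrow> z 0 = q \<longrightarrow>
        (\<forall>t\<in>{0..T}. dist (z t) p < e) \<longrightarrow> Q (q - p) (q - p) + m * T \<le> Q (z T - p) (z T - p))"
      unfolding G_def using \<open>q \<in> U\<close> dq \<open>m > 0\<close>
      by (intro bexI[of _ q] conjI exI[of _ m] allI impI)
  qed (rule \<open>e > 0\<close>)
qed

text \<open>The hypothesis on \<open>A\<close> is the factorization of its annihilating polynomial into
\<open>\<lambda>^2 - s \<lambda> + \<kappa>\<close> and \<open>\<lambda>^2 + s \<lambda> + \<kappa>\<close>, whose roots are nonreal with real parts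
\<open>s / 2\<close> and \<open>- s / 2\<close>. Applying one factor to a vector kills the part belonging to the other
pair: \<open>u\<close> below keeps the expanding and \<open>w\<close> the contracting part. On each part \<open>A\<close> is
\<open>s / 2\<close> or \<open>- s / 2\<close> plus an oscillator of squared frequency \<open>\<omega>\<close>, and the energy of that oscillator
is multiplied by a pure exponential. The difference of the two energies is the required form;
it takes a positive value because the expanding part of \<open>v\<close> is nonzero.\<close>

lemma lyapunov_unstable_if_complex_quadruple:
  fixes X A :: "'a::euclidean_space \<Rightarrow> 'a"
  assumes U: "open U" "p \<in> U" "X p = 0" "(X has_derivative A) (at p)"
    and "s > 0" and disc: "s\<^sup>2 < 4 * \<kappa>"
    and char: "\<And>x. A (A (A (A x))) + (2 * \<kappa> - s\<^sup>2) *\<^sub>R A (A x) + \<kappa>\<^sup>2 *\<^sub>R x = 0"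
    and v: "A (A v) + s *\<^sub>R A v + \<kappa> *\<^sub>R v \<noteq> 0"
  shows "lyapunov_unstable X U p"
proof -
  have A: "linear A" using U(4) by (rule has_derivative_linear)
  note lin = linear_add[OF A] linear_scale[OF A] linear_diff[OF A]
  have "\<kappa> > 0" using disc zero_le_power2[of s] by linarith
  define \<omega> where "\<omega> = \<kappa> - s\<^sup>2 / 4"
  have "\<omega> > 0" using disc by (simp add: \<omega>_def)
  have A4: "A (A (A (A x))) = (s\<^sup>2 - 2 * \<kappa>) *\<^sub>R A (A x) - \<kappa>\<^sup>2 *\<^sub>R x" for x
    using char[of x] by (simp add: algebra_simps eq_neg_iff_add_eq_0)
  define u w where "u x = A (A x) + s *\<^sub>R A x + \<kappa> *\<^sub>R x" and "w x = A (A x) - s *\<^sub>R A x + \<kappa> *\<^sub>R x" for x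
  have linuw: "u (x + y) = u x + u y" "u (k *\<^sub>R x) = k *\<^sub>R u x" "w (x + y) = w x + w y" "w (k *\<^sub>R x) = k *\<^sub>R w x"
    for x y k by (simp_all add: u_def w_def lin algebra_simps)
  have comm: "u (A x) = A (u x)" "w (A x) = A (w x)" for x by (simp_all add: u_def w_def lin)
  have double: "(k * 2) *\<^sub>R x = k *\<^sub>R x + k *\<^sub>R x" and half: "(k / 2) *\<^sub>R x + (k / 2) *\<^sub>R x = k *\<^sub>R x" for k and x :: 'a
    by (simp_all add: scaleR_left_distrib[symmetric])
  have AAu: "A (A (u x)) = s *\<^sub>R A (u x) - \<kappa> *\<^sub>R u x" and AAw: "A (A (w x)) = - s *\<^sub>R A (w x) - \<kappa> *\<^sub>R w x" for x
    by (simp_all add: u_def w_def lin A4 double algebra_simps power2_eq_square)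
  have diff: "u x - w x = (2 * s) *\<^sub>R A x" for x
    by (simp add: u_def w_def double algebra_simps)
  \<comment> \<open>\<open>f\<close> and \<open>g\<close> are the velocities of \<open>u\<close> and \<open>w\<close> once the exponential factors are split off.\<close>
  define f g where "f x = A (u x) - (s / 2) *\<^sub>R u x" and "g x = A (w x) + (s / 2) *\<^sub>R w x" for x
  have linfg: "f (x + y) = f x + f y" "f (k *\<^sub>R x) = k *\<^sub>R f x" "g (x + y) = g x + g y" "g (k *\<^sub>R x) = k *\<^sub>R g x"
    for x y k by (simp_all add: f_def g_def lin linuw algebra_simps)
  have uA: "u (A x) = f x + (s / 2) *\<^sub>R u x" and wA: "w (A x) = g x - (s / 2) *\<^sub>R w x" for x
    by (simp_all add: f_def g_def comm)
  have fA: "f (A x) = (s / 2) *\<^sub>R f x - \<omega> *\<^sub>R u x" and gA: "g (A x) = - (s / 2) *\<^sub>R g x - \<omega> *\<^sub>R w x" for x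
    by (simp_all add: f_def g_def \<omega>_def comm AAu AAw half algebra_simps power2_eq_square)
  define Q where "Q x y = \<omega> * (u x \<bullet> u y) + f x \<bullet> f y - (\<omega> * (w x \<bullet> w y) + g x \<bullet> g y)" for x y
  have Q: "bilinear Q" unfolding Q_def bilinear_def linear_iff
    by (simp only: linuw linfg inner_simps) (simp add: algebra_simps)
  have drift: "Q h (A h) + Q (A h) h =
      s * (\<omega> * (norm (u h))\<^sup>2 + (norm (f h))\<^sup>2 + \<omega> * (norm (w h))\<^sup>2 + (norm (g h))\<^sup>2)" for h
    unfolding Q_def uA wA fA gA power2_norm_eq_inner
    by (simp add: inner_simps inner_commute[of "f h" "u h"] inner_commute[of "g h" "w h"] algebra_simps)
  obtain B where "B > 0" and B: "\<And>x. norm (A x) \<le> B * norm x"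
    using linear_bounded_pos[OF A] by auto
  \<comment> \<open>Both \<open>A h\<close> and \<open>A (A h) + \<kappa> h\<close> are combinations of \<open>u h\<close> and \<open>w h\<close>, and they determine \<open>h\<close>.\<close>
  define L where "L = (1 + B / s) / (2 * \<kappa>)"
  have "L > 0" using \<open>B > 0\<close> \<open>s > 0\<close> \<open>\<kappa> > 0\<close> by (simp add: L_def add_pos_pos)
  have hL: "norm h \<le> L * (norm (u h) + norm (w h))" for h
  proof -
    have "(2 * \<kappa>) *\<^sub>R h = (u h + w h) - (1 / s) *\<^sub>R A (u h - w h)"
      using \<open>s > 0\<close> by (simp add: u_def w_def lin algebra_simps scaleR_2[symmetric])
    then have "2 * \<kappa> * norm h = norm ((u h + w h) - (1 / s) *\<^sub>R A (u h - w h))"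
      using \<open>\<kappa> > 0\<close> by (metis abs_of_pos norm_scaleR mult_pos_pos zero_less_numeral)
    also have "\<dots> \<le> norm (u h + w h) + (1 / s) * norm (A (u h - w h))"
      using norm_triangle_ineq4[of "u h + w h" "(1 / s) *\<^sub>R A (u h - w h)"] \<open>s > 0\<close> by simp
    also have "\<dots> \<le> (norm (u h) + norm (w h)) + (1 / s) * (B * (norm (u h) + norm (w h)))"
      using \<open>s > 0\<close> \<open>B > 0\<close>
      by (intro add_mono norm_triangle_ineq mult_left_mono order_trans[OF B] norm_triangle_ineq4) auto
    finally show ?thesis using \<open>s > 0\<close> \<open>\<kappa> > 0\<close> by (simp add: L_def field_simps)
  qed
  define c where "c = s * \<omega> / (2 * L\<^sup>2)"
  have "c > 0" using \<open>s > 0\<close> \<open>\<omega> > 0\<close> \<open>L > 0\<close> by (simp add: c_def)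
  have "c * (norm h)\<^sup>2 \<le> Q h (A h) + Q (A h) h" for h
  proof -
    have "(norm h)\<^sup>2 \<le> (L * (norm (u h) + norm (w h)))\<^sup>2" using hL by (intro power_mono) auto
    also have "\<dots> \<le> L\<^sup>2 * (2 * ((norm (u h))\<^sup>2 + (norm (w h))\<^sup>2))"
      unfolding power_mult_distrib
      using sum_squares_bound[of "norm (u h)" "norm (w h)"] by (intro mult_left_mono) (auto simp: power2_sum)
    finally have "c * (norm h)\<^sup>2 \<le> c * (L\<^sup>2 * (2 * ((norm (u h))\<^sup>2 + (norm (w h))\<^sup>2)))"
      using \<open>c > 0\<close> by (intro mult_left_mono) auto
    also have "\<dots> = s * (\<omega> * ((norm (u h))\<^sup>2 + (norm (w h))\<^sup>2))"
      using \<open>L > 0\<close> by (simp add: c_def)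
    also have "\<dots> \<le> Q h (A h) + Q (A h) h"
      unfolding drift using \<open>s > 0\<close> by (intro mult_left_mono) (auto simp: algebra_simps)
    finally show ?thesis .
  qed
  \<comment> \<open>\<open>u v\<close> is purely expanding: the other factor annihilates it.\<close>
  moreover have "Q (u v) (u v) > 0"
  proof -
    have w0: "w (u v) = 0"
      by (simp add: w_def AAu)
    then have "u (u v) = (2 * s) *\<^sub>R A (u v)"
      using diff[of "u v"] by simp
    moreover have "A (u v) \<noteq> 0"
      using AAu[of v] v \<open>\<kappa> > 0\<close> linear_0[OF A] by (auto simp: u_def[of v, symmetric])
    ultimately have "u (u v) \<noteq> 0" using \<open>s > 0\<close> by simp
    moreover have "g (u v) = 0" by (simp add: g_def w0 linear_0[OF A])
    ultimately show ?thesis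
      using \<open>\<omega> > 0\<close> by (simp add: Q_def w0 add_pos_nonneg)
  qed
  ultimately show ?thesis
    using U Q \<open>c > 0\<close> by (intro lyapunov_unstable_if_chetaev_form[of U p X A Q c "u v"])
qed

section \<open>Stability from two distinct frequencies\<close>

text \<open>The space splits into a part \<open>p\<close> on which \<open>A^2 = - a\<close> and a part \<open>r\<close> on which
\<open>A^2 = - b\<close>; since \<open>a \<noteq> b\<close> both projections are polynomials in \<open>A\<close>. On each part the
solutions through a given point are explicit harmonic oscillations, and the sum of the
two oscillator energies is a positive definite first integral, which bounds all solutions at once without
appeal to uniqueness.\<close>

lemma lyapunov_stable_if_two_frequencies:
  fixes A :: "'a::euclidean_space \<Rightarrow> 'a"
  assumes A: "linear A" and "a > 0" and "b > 0" and "a \<noteq> b"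
    and char: "\<And>x. A (A (A (A x))) + (a + b) *\<^sub>R A (A x) + (a * b) *\<^sub>R x = 0"
  shows "lyapunov_stable A UNIV 0"
proof -
  note lin = linear_add[OF A] linear_scale[OF A] linear_diff[OF A]
  have A4: "A (A (A (A x))) = - (a + b) *\<^sub>R A (A x) - (a * b) *\<^sub>R x" for x
    using char[of x] by (simp add: algebra_simps eq_neg_iff_add_eq_0)
  define p r where "p x = (1 / (b - a)) *\<^sub>R (A (A x) + b *\<^sub>R x)" and
    "r x = (1 / (a - b)) *\<^sub>R (A (A x) + a *\<^sub>R x)" for x
  have linpr: "p (x + y) = p x + p y" "p (k *\<^sub>R x) = k *\<^sub>R p x" "r (x + y) = r x + r y" "r (k *\<^sub>R x) = k *\<^sub>R r x"
    for x y k by (simp_all add: p_def r_def lin algebra_simps)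
  have comm: "p (A x) = A (p x)" "r (A x) = A (r x)" for x by (simp_all add: p_def r_def lin)
  have AAp: "A (A (p x)) = - a *\<^sub>R p x" and AAr: "A (A (r x)) = - b *\<^sub>R r x" for x
    by (simp_all add: p_def r_def lin A4 algebra_simps)
  have split: "p x + r x = x" for x
  proof -
    have "1 / (a - b) = - 1 / (b - a)" using \<open>a \<noteq> b\<close> by (simp add: field_simps)
    then have r: "r x = - ((1 / (b - a)) *\<^sub>R (A (A x) + a *\<^sub>R x))" by (simp only: r_def) simp
    have "p x + r x = (1 / (b - a)) *\<^sub>R ((A (A x) + b *\<^sub>R x) - (A (A x) + a *\<^sub>R x))"
      unfolding p_def r scaleR_diff_right by simp
    also have "(A (A x) + b *\<^sub>R x) - (A (A x) + a *\<^sub>R x) = (b - a) *\<^sub>R x" by (simp add: algebra_simps)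
    finally have "p x + r x = (1 / (b - a)) *\<^sub>R ((b - a) *\<^sub>R x)" .
    then show ?thesis using \<open>a \<noteq> b\<close> by simp
  qed
  have exist: "\<exists>z. solution_on A UNIV {0..} z \<and> z 0 = q" for q
  proof -
    define \<alpha> \<beta> where "\<alpha> = sqrt a" and "\<beta> = sqrt b"
    have ab: "\<alpha> > 0" "\<beta> > 0" "a = \<alpha> * \<alpha>" "b = \<beta> * \<beta>" using assms by (auto simp: \<alpha>_def \<beta>_def)
    define z where "z t = cos (\<alpha> * t) *\<^sub>R p q + (sin (\<alpha> * t) / \<alpha>) *\<^sub>R A (p q)
      + (cos (\<beta> * t) *\<^sub>R r q + (sin (\<beta> * t) / \<beta>) *\<^sub>R A (r q))" for t
    have osc: "((\<lambda>t. cos (\<nu> * t) *\<^sub>R x + (sin (\<nu> * t) / \<nu>) *\<^sub>R y) has_vector_derivative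
        (- \<nu> * sin (\<nu> * t)) *\<^sub>R x + cos (\<nu> * t) *\<^sub>R y) (at t within S)"
      if "\<nu> > 0" for \<nu> t S and x y :: 'a
    proof -
      have c: "((\<lambda>t. cos (\<nu> * t)) has_real_derivative - \<nu> * sin (\<nu> * t)) (at t within S)"
        and s: "((\<lambda>t. sin (\<nu> * t) / \<nu>) has_real_derivative cos (\<nu> * t)) (at t within S)"
        using that by (auto intro!: derivative_eq_intros)
      from has_vector_derivative_add[OF has_vector_derivative_scaleR[OF c has_vector_derivative_const]
          has_vector_derivative_scaleR[OF s has_vector_derivative_const]]
      show ?thesis by simp
    qed
    have "(z has_vector_derivative A (z t)) (at t within {0..})" for t
    proof -
      have "A (z t) = (- \<alpha> * sin (\<alpha> * t)) *\<^sub>R p q + cos (\<alpha> * t) *\<^sub>R A (p q)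
          + ((- \<beta> * sin (\<beta> * t)) *\<^sub>R r q + cos (\<beta> * t) *\<^sub>R A (r q))"
        unfolding z_def lin AAp AAr using ab by (simp add: algebra_simps)
      then show ?thesis
        using has_vector_derivative_add[OF osc[OF ab(1)] osc[OF ab(2)]] unfolding z_def by simp
    qed
    moreover have "z 0 = q" by (simp add: z_def split)
    ultimately show ?thesis by (auto simp: solution_on_def)
  qed
  define E where "E x y = (a * (p x \<bullet> p y) + A (p x) \<bullet> A (p y)) + (b * (r x \<bullet> r y) + A (r x) \<bullet> A (r y))" for x y
  have E: "bilinear E" unfolding E_def bilinear_def linear_iff
    by (simp only: lin linpr inner_simps) (simp add: algebra_simps)
  have conserved: "E h (A h) + E (A h) h = 0" for h
    by (simp add: E_def comm AAp AAr inner_commute)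
  obtain K where "K > 0" and K: "\<And>x y. \<bar>E x y\<bar> \<le> K * norm x * norm y"
    using bilinear_bounded_pos[OF E] by auto
  define m where "m = min a b"
  have "m > 0" using assms by (simp add: m_def)
  have lower: "m * (norm x)\<^sup>2 \<le> 2 * E x x" for x
  proof -
    have "(norm x)\<^sup>2 \<le> (norm (p x) + norm (r x))\<^sup>2"
      using norm_triangle_ineq[of "p x" "r x"] by (intro power_mono) (auto simp: split)
    also have "\<dots> \<le> 2 * ((norm (p x))\<^sup>2 + (norm (r x))\<^sup>2)"
      using sum_squares_bound[of "norm (p x)" "norm (r x)"] by (simp add: power2_sum)
    finally have "m * (norm x)\<^sup>2 \<le> m * (2 * ((norm (p x))\<^sup>2 + (norm (r x))\<^sup>2))"
      using \<open>m > 0\<close> by (intro mult_left_mono) auto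
    also have "\<dots> = 2 * (m * (norm (p x))\<^sup>2 + m * (norm (r x))\<^sup>2)" by (simp add: algebra_simps)
    also have "\<dots> \<le> 2 * (a * (norm (p x))\<^sup>2 + b * (norm (r x))\<^sup>2)"
      by (intro mult_left_mono add_mono mult_right_mono) (auto simp: m_def)
    also have "\<dots> \<le> 2 * E x x"
      by (simp add: E_def power2_norm_eq_inner)
    finally show ?thesis .
  qed
  define C where "C = 2 * K / m"
  have "C > 0" using \<open>K > 0\<close> \<open>m > 0\<close> by (simp add: C_def)
  have bounded: "(norm (z t))\<^sup>2 \<le> C * (norm (z 0))\<^sup>2"
    if z: "solution_on A UNIV {0..T} z" and t: "t \<in> {0..T}" for z t T
  proof -
    have along: "((\<lambda>s. - E (z s) (z s)) has_vector_derivative 0) (at s within {0..t})" if "s \<in> {0..t}" for s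
    proof -
      have "(z has_vector_derivative A (z s)) (at s within {0..t})"
        using z that t unfolding solution_on_def
        by (auto intro: has_vector_derivative_within_subset[of z _ _ "{0..T}"])
      from has_vector_derivative_minus[OF bilinear_along_solution[OF E this, of 0]] show ?thesis
        by (simp add: conserved)
    qed
    have "- E (z 0) (z 0) + 0 * t \<le> - E (z t) (z t)"
      using t by (intro increment_ge_if_derivative_ge[OF _ along]) auto
    then have "m * (norm (z t))\<^sup>2 \<le> 2 * E (z 0) (z 0)" using lower[of "z t"] by simp
    also have "\<dots> \<le> 2 * (K * (norm (z 0))\<^sup>2)"
      using K[of "z 0" "z 0"] by (simp add: power2_eq_square mult.assoc)
    finally show ?thesis using \<open>m > 0\<close> by (simp add: C_def field_simps)
  qed
  have "\<exists>d>0. \<forall>q\<in>UNIV. dist q 0 < d \<longrightarrow> (\<exists>z. solution_on A UNIV {0..} z \<and> z 0 = q) \<and>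
      (\<forall>T\<ge>0. \<forall>z. solution_on A UNIV {0..T} z \<and> z 0 = q \<longrightarrow> (\<forall>t\<in>{0..T}. dist (z t) 0 < e))"
    if "e > 0" for e
  proof (intro exI[of _ "e / sqrt C"] conjI ballI impI allI exist)
    show "e / sqrt C > 0" using \<open>e > 0\<close> \<open>C > 0\<close> by simp
    fix q T z t assume q: "dist q 0 < e / sqrt C" and "0 \<le> T"
      and z: "solution_on A UNIV {0..T} z \<and> z 0 = q" and t: "t \<in> {0..T}"
    have "norm q < e / sqrt C" using q by simp
    then have "(norm q)\<^sup>2 < (e / sqrt C)\<^sup>2" by (intro power_strict_mono) auto
    then have "C * (norm q)\<^sup>2 < e\<^sup>2" using \<open>C > 0\<close> by (simp add: power_divide field_simps)
    with bounded[of T z t] z t have "(norm (z t))\<^sup>2 < e\<^sup>2" by auto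
    then show "dist (z t) 0 < e" using \<open>e > 0\<close> by (simp add: power2_less_imp_less)
  qed
  then show ?thesis
    using linear_0[OF A] by (simp add: lyapunov_stable_def equilibrium_def)
qed

section \<open>The Hamiltonian vector field near an equilibrium\<close>

lemma vector_4 [simp]:
  "(vector [a, b, c, d] :: 'a::zero^4) $ 1 = a" "(vector [a, b, c, d] :: 'a^4) $ 2 = b"
  "(vector [a, b, c, d] :: 'a^4) $ 3 = c" "(vector [a, b, c, d] :: 'a^4) $ 4 = d"
  by (simp_all add: vector_def)

lemma has_derivative_componentwise_vec:
  fixes f :: "'a::euclidean_space \<Rightarrow> real^'n"
  assumes "\<And>i. ((\<lambda>x. f x $ i) has_derivative (\<lambda>h. f' h $ i)) (at x)"
  shows "(f has_derivative f') (at x)"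
  unfolding has_derivative_componentwise_within[of f f' x UNIV]
  using assms by (auto simp: Basis_vec_def inner_axis)

lemma inverse_distance_derivative:
  fixes r :: "real \<Rightarrow> real"
  assumes "(r has_real_derivative 1) (at s)" and "sqrt ((r s)\<^sup>2 + w\<^sup>2) \<noteq> 0"
  shows "((\<lambda>s. k / sqrt ((r s)\<^sup>2 + w\<^sup>2)) has_real_derivative - (k * (r s / sqrt ((r s)\<^sup>2 + w\<^sup>2) ^ 3))) (at s)"
proof -
  define \<rho> where "\<rho> = sqrt ((r s)\<^sup>2 + w\<^sup>2)"
  have pos: "(r s)\<^sup>2 + w\<^sup>2 > 0" using assms(2) by (simp add: sum_power2_gt_zero_iff)
  have "((\<lambda>s. sqrt ((r s)\<^sup>2 + w\<^sup>2)) has_real_derivative r s / \<rho>) (at s)"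
    using pos assms(1) by (auto intro!: derivative_eq_intros simp: \<rho>_def field_simps)
  moreover have "\<rho> \<noteq> 0" using assms(2) by (simp only: \<rho>_def not_False_eq_True)
  ultimately have "((\<lambda>s. k / sqrt ((r s)\<^sup>2 + w\<^sup>2)) has_real_derivative (0 * \<rho> - k * (r s / \<rho>)) / (\<rho> * \<rho>)) (at s)"
    unfolding \<rho>_def by (rule DERIV_divide[OF DERIV_const[of k]])
  then show ?thesis
    unfolding \<rho>_def[symmetric] by (rule DERIV_cong) (simp add: power3_eq_cube mult.assoc)
qed

lemma potV_gradient:
  assumes "rho1 \<mu> x y \<noteq> 0" and "rho2 \<mu> x y \<noteq> 0"
  shows "potV_x \<mu> \<beta>\<^sub>1 \<beta>\<^sub>2 x y = - (\<beta>\<^sub>1 * (1 - \<mu>) * ((x + \<mu>) / rho1 \<mu> x y ^ 3)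
      + \<beta>\<^sub>2 * \<mu> * ((x - 1 + \<mu>) / rho2 \<mu> x y ^ 3))"
    and "potV_y \<mu> \<beta>\<^sub>1 \<beta>\<^sub>2 x y = - (\<beta>\<^sub>1 * (1 - \<mu>) * (y / rho1 \<mu> x y ^ 3)
      + \<beta>\<^sub>2 * \<mu> * (y / rho2 \<mu> x y ^ 3))"
proof -
  have "((\<lambda>s. potV \<mu> \<beta>\<^sub>1 \<beta>\<^sub>2 s y) has_real_derivative - (\<beta>\<^sub>1 * (1 - \<mu>) * ((x + \<mu>) / rho1 \<mu> x y ^ 3))
      + - (\<beta>\<^sub>2 * \<mu> * ((x - 1 + \<mu>) / rho2 \<mu> x y ^ 3))) (at x)"
    using assms unfolding potV_def rho1_def rho2_def
    by (intro DERIV_add inverse_distance_derivative) (auto intro!: derivative_eq_intros)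
  then show "potV_x \<mu> \<beta>\<^sub>1 \<beta>\<^sub>2 x y = - (\<beta>\<^sub>1 * (1 - \<mu>) * ((x + \<mu>) / rho1 \<mu> x y ^ 3)
      + \<beta>\<^sub>2 * \<mu> * ((x - 1 + \<mu>) / rho2 \<mu> x y ^ 3))"
    by (simp add: potV_x_def DERIV_imp_deriv)
  have r: "rho1 \<mu> x s = sqrt (s\<^sup>2 + (x + \<mu>)\<^sup>2)" "rho2 \<mu> x s = sqrt (s\<^sup>2 + (x - 1 + \<mu>)\<^sup>2)" for s
    by (simp_all only: rho1_def rho2_def add.commute)
  have "((\<lambda>s. potV \<mu> \<beta>\<^sub>1 \<beta>\<^sub>2 x s) has_real_derivative - (\<beta>\<^sub>1 * (1 - \<mu>) * (y / rho1 \<mu> x y ^ 3))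
      + - (\<beta>\<^sub>2 * \<mu> * (y / rho2 \<mu> x y ^ 3))) (at y)"
    using assms unfolding potV_def r
    by (intro DERIV_add inverse_distance_derivative) auto
  then show "potV_y \<mu> \<beta>\<^sub>1 \<beta>\<^sub>2 x y = - (\<beta>\<^sub>1 * (1 - \<mu>) * (y / rho1 \<mu> x y ^ 3)
      + \<beta>\<^sub>2 * \<mu> * (y / rho2 \<mu> x y ^ 3))"
    by (simp add: potV_y_def DERIV_imp_deriv)
qed

lemma open_phase_space: "open (phase_space \<mu>)"
  unfolding phase_space_def rho1_def rho2_def
  by (intro open_Collect_conj open_Collect_neq continuous_intros)

lemma inverse_square_force_has_derivative:
  fixes u v :: "'a::real_normed_vector \<Rightarrow> real"
  assumes u: "(u has_derivative u') (at p)" and v: "(v has_derivative v') (at p)"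
    and \<rho>: "\<rho> = sqrt ((u p)\<^sup>2 + (v p)\<^sup>2)" "\<rho> \<noteq> 0"
  shows "((\<lambda>z. u z / sqrt ((u z)\<^sup>2 + (v z)\<^sup>2) ^ 3) has_derivative
    (\<lambda>h. (u' h - 3 * u p * (u p * u' h + v p * v' h) / \<rho>\<^sup>2) / \<rho> ^ 3)) (at p)"
proof -
  have pos: "(u p)\<^sup>2 + (v p)\<^sup>2 > 0" using \<rho> by (simp add: sum_power2_gt_zero_iff)
  have "((\<lambda>z. sqrt ((u z)\<^sup>2 + (v z)\<^sup>2)) has_derivative (\<lambda>h. (u p * u' h + v p * v' h) / \<rho>)) (at p)"
    using pos u v \<rho> by (auto intro!: derivative_eq_intros simp: field_simps)
  from has_derivative_divide'[OF u has_derivative_power[OF this, of 3]] \<rho>(2)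
  have "((\<lambda>z. u z / sqrt ((u z)\<^sup>2 + (v z)\<^sup>2) ^ 3) has_derivative
    (\<lambda>h. (u' h * \<rho> ^ 3 - u p * (3 * ((u p * u' h + v p * v' h) / \<rho>) * \<rho>\<^sup>2)) / (\<rho> ^ 3 * \<rho> ^ 3))) (at p)"
    unfolding \<rho>(1)[symmetric] by (simp add: mult_ac)
  moreover have "(u' h * \<rho> ^ 3 - u p * (3 * ((u p * u' h + v p * v' h) / \<rho>) * \<rho>\<^sup>2)) / (\<rho> ^ 3 * \<rho> ^ 3) =
      (u' h - 3 * u p * (u p * u' h + v p * v' h) / \<rho>\<^sup>2) / \<rho> ^ 3" for h
    using \<rho>(2) by (simp add: divide_simps) (simp add: algebra_simps eval_nat_numeral)
  ultimately show ?thesis by simp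
qed

text \<open>The linear part of the vector field when the potential has the Hessian matrix with rows
\<open>(a, b)\<close> and \<open>(b, c)\<close>.\<close>

definition hessian_field :: "real \<Rightarrow> real \<Rightarrow> real \<Rightarrow> real^4 \<Rightarrow> real^4" where
  "hessian_field a b c h =
     vector [h $ 2 + h $ 3, - h $ 1 + h $ 4, a * h $ 1 + b * h $ 2 + h $ 4, b * h $ 1 + c * h $ 2 - h $ 3]"

lemma linear_hessian_field: "linear (hessian_field a b c)"
  by (simp add: linear_iff hessian_field_def vec_eq_iff forall_4 algebra_simps)

text \<open>Eliminating the momenta gives the planar system \<open>x'' = 2 y' + (1 + a) x + b y\<close>,
\<open>y'' = - 2 x' + b x + (1 + c) y\<close> with characteristic polynomial
\<open>\<lambda>^4 + (2 - a - c) \<lambda>^2 + ((1 + a) (1 + c) - b^2)\<close>; this is the Cayley--Hamilton identity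
for the value \<open>a + c = 1\<close> of the Laplacian of the potential.\<close>

lemma hessian_field_characteristic:
  assumes "a + c = 1" and "(1 + a) * (1 + c) - b\<^sup>2 = k"
  defines "L \<equiv> hessian_field a b c"
  shows "L (L (L (L h))) + L (L h) + k *\<^sub>R h = 0"
proof -
  have c: "c = 1 - a" and k: "k = (1 + a) * (2 - a) - b * b"
    using assms(1,2) by (auto simp: power2_eq_square)
  show ?thesis
    unfolding L_def k c by (simp add: hessian_field_def vec_eq_iff forall_4 algebra_simps)
qed

text \<open>At the distances \<open>root 3 \<beta>\<^sub>i\<close> each charge cancels against the cube of the distance, so that the Hessian
of the potential depends only on \<open>\<mu>\<close> and on the directions to the primaries: with unit vectors
\<open>e\<^sub>1\<close>, \<open>e\<^sub>2\<close> it is \<open>3 (1 - \<mu>) e\<^sub>1 e\<^sub>1\<^sup>T + 3 \<mu> e\<^sub>2 e\<^sub>2\<^sup>T\<close> minus the identity.\<close>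

lemma charged_field_has_derivative:
  assumes m: "\<beta>\<^sub>1 > 0" "\<beta>\<^sub>2 > 0"
    and r: "rho1 \<mu> (p $ 1) (p $ 2) = root 3 \<beta>\<^sub>1" "rho2 \<mu> (p $ 1) (p $ 2) = root 3 \<beta>\<^sub>2"
    and uv: "u = p $ 1 + \<mu>" "v = p $ 1 - 1 + \<mu>" "y = p $ 2"
    and abc: "a = 3 * ((1 - \<mu>) * u\<^sup>2 / (root 3 \<beta>\<^sub>1)\<^sup>2 + \<mu> * v\<^sup>2 / (root 3 \<beta>\<^sub>2)\<^sup>2) - 1"
      "b = 3 * ((1 - \<mu>) * u * y / (root 3 \<beta>\<^sub>1)\<^sup>2 + \<mu> * v * y / (root 3 \<beta>\<^sub>2)\<^sup>2)"
      "c = 3 * ((1 - \<mu>) * y\<^sup>2 / (root 3 \<beta>\<^sub>1)\<^sup>2 + \<mu> * y\<^sup>2 / (root 3 \<beta>\<^sub>2)\<^sup>2) - 1"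
  shows "(charged_field \<mu> \<beta>\<^sub>1 \<beta>\<^sub>2 has_derivative hessian_field a b c) (at p)"
proof -
  define \<delta> \<epsilon> where "\<delta> = root 3 \<beta>\<^sub>1" and "\<epsilon> = root 3 \<beta>\<^sub>2"
  have pos: "\<delta> > 0" "\<epsilon> > 0" and cube: "\<beta>\<^sub>1 = \<delta> ^ 3" "\<beta>\<^sub>2 = \<epsilon> ^ 3" using m by (simp_all add: \<delta>_def \<epsilon>_def)
  note abc' = abc[folded \<delta>_def \<epsilon>_def]
  have coord: "((\<lambda>z :: real^4. z $ i) has_derivative (\<lambda>h. h $ i)) (at p)" for i
    by (rule bounded_linear_imp_has_derivative[OF bounded_linear_vec_nth])
  have X1: "((\<lambda>z :: real^4. z $ 1 + \<mu>) has_derivative (\<lambda>h. h $ 1)) (at p)"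
    and X2: "((\<lambda>z :: real^4. z $ 1 - 1 + \<mu>) has_derivative (\<lambda>h. h $ 1)) (at p)"
    by (auto intro!: derivative_eq_intros coord)
  have d: "\<delta> = sqrt (u\<^sup>2 + y\<^sup>2)" "\<epsilon> = sqrt (v\<^sup>2 + y\<^sup>2)"
    using r by (simp_all add: rho1_def rho2_def \<delta>_def \<epsilon>_def uv)
  have d': "\<delta> = sqrt (y\<^sup>2 + u\<^sup>2)" "\<epsilon> = sqrt (y\<^sup>2 + v\<^sup>2)" using d by (simp_all add: add.commute)
  define F1 F2 :: "real^4 \<Rightarrow> real" where
    "F1 z = - (\<beta>\<^sub>1 * (1 - \<mu>) * ((z $ 1 + \<mu>) / rho1 \<mu> (z $ 1) (z $ 2) ^ 3)
      + \<beta>\<^sub>2 * \<mu> * ((z $ 1 - 1 + \<mu>) / rho2 \<mu> (z $ 1) (z $ 2) ^ 3))" and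
    "F2 z = - (\<beta>\<^sub>1 * (1 - \<mu>) * (z $ 2 / rho1 \<mu> (z $ 1) (z $ 2) ^ 3)
      + \<beta>\<^sub>2 * \<mu> * (z $ 2 / rho2 \<mu> (z $ 1) (z $ 2) ^ 3))" for z
  define G where "G z = (vector [z $ 2 + z $ 3, - z $ 1 + z $ 4, F1 z + z $ 4, F2 z - z $ 3] :: real^4)" for z
  have "(F1 has_derivative (\<lambda>h. a * h $ 1 + b * h $ 2)) (at p)"
  proof -
    have "(F1 has_derivative (\<lambda>h. - (\<beta>\<^sub>1 * (1 - \<mu>) * ((h $ 1 - 3 * u * (u * h $ 1 + y * h $ 2) / \<delta>\<^sup>2) / \<delta> ^ 3)
        + \<beta>\<^sub>2 * \<mu> * ((h $ 1 - 3 * v * (v * h $ 1 + y * h $ 2) / \<epsilon>\<^sup>2) / \<epsilon> ^ 3)))) (at p)"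
      unfolding F1_def rho1_def rho2_def uv
      by (intro has_derivative_minus has_derivative_add has_derivative_mult_right
          inverse_square_force_has_derivative[OF X1 coord] inverse_square_force_has_derivative[OF X2 coord])
        (use d pos in \<open>auto simp: uv sum_power2_gt_zero_iff\<close>)
    moreover have "- (\<beta>\<^sub>1 * (1 - \<mu>) * ((h $ 1 - 3 * u * (u * h $ 1 + y * h $ 2) / \<delta>\<^sup>2) / \<delta> ^ 3)
        + \<beta>\<^sub>2 * \<mu> * ((h $ 1 - 3 * v * (v * h $ 1 + y * h $ 2) / \<epsilon>\<^sup>2) / \<epsilon> ^ 3)) = a * h $ 1 + b * h $ 2" for h :: "real^4"
      using pos unfolding abc' cube by (simp add: add_divide_distrib diff_divide_distrib power2_eq_square algebra_simps)
    ultimately show ?thesis by simp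
  qed
  moreover have "(F2 has_derivative (\<lambda>h. b * h $ 1 + c * h $ 2)) (at p)"
  proof -
    have swap: "rho1 \<mu> s t = sqrt (t\<^sup>2 + (s + \<mu>)\<^sup>2)" "rho2 \<mu> s t = sqrt (t\<^sup>2 + (s - 1 + \<mu>)\<^sup>2)" for s t
      by (simp_all only: rho1_def rho2_def add.commute)
    have "(F2 has_derivative (\<lambda>h. - (\<beta>\<^sub>1 * (1 - \<mu>) * ((h $ 2 - 3 * y * (y * h $ 2 + u * h $ 1) / \<delta>\<^sup>2) / \<delta> ^ 3)
        + \<beta>\<^sub>2 * \<mu> * ((h $ 2 - 3 * y * (y * h $ 2 + v * h $ 1) / \<epsilon>\<^sup>2) / \<epsilon> ^ 3)))) (at p)"
      unfolding F2_def swap uv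
      by (intro has_derivative_minus has_derivative_add has_derivative_mult_right
          inverse_square_force_has_derivative[OF coord X1] inverse_square_force_has_derivative[OF coord X2])
        (use d' pos in \<open>auto simp: uv sum_power2_gt_zero_iff\<close>)
    moreover have "- (\<beta>\<^sub>1 * (1 - \<mu>) * ((h $ 2 - 3 * y * (y * h $ 2 + u * h $ 1) / \<delta>\<^sup>2) / \<delta> ^ 3)
        + \<beta>\<^sub>2 * \<mu> * ((h $ 2 - 3 * y * (y * h $ 2 + v * h $ 1) / \<epsilon>\<^sup>2) / \<epsilon> ^ 3)) = b * h $ 1 + c * h $ 2" for h :: "real^4"
      using pos unfolding abc' cube by (simp add: add_divide_distrib diff_divide_distrib power2_eq_square algebra_simps)
    ultimately show ?thesis by simp
  qed
  ultimately have "((\<lambda>z. G z $ i) has_derivative (\<lambda>h. hessian_field a b c h $ i)) (at p)" for i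
    using exhaust_4[of i] unfolding G_def hessian_field_def
    by (elim disjE) (auto intro!: derivative_intros coord)
  then have "(G has_derivative hessian_field a b c) (at p)"
    by (rule has_derivative_componentwise_vec)
  moreover have "p \<in> phase_space \<mu>" using r m by (simp add: phase_space_def)
  moreover have "G z = charged_field \<mu> \<beta>\<^sub>1 \<beta>\<^sub>2 z" if "z \<in> phase_space \<mu>" for z
    using that by (simp add: G_def charged_field_def F1_def F2_def phase_space_def potV_gradient)
  ultimately show ?thesis
    using has_derivative_transform_within_open[OF _ open_phase_space] by blast
qed

section \<open>Geometry of the equilibria\<close>

text \<open>Off the axis the second force equation says that the ratios \<open>\<beta>\<^sub>1 / \<rho>\<^sub>1^3\<close> and \<open>\<beta>\<^sub>2 / \<rho>\<^sub>2^3\<close>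
have weighted mean \<open>1\<close>; the first one then forces them to be equal.\<close>

lemma triangular_equilibrium_distances:
  assumes "0 < \<mu>" "\<mu> < 1" and eq: "triangular_equilibrium \<mu> \<beta>\<^sub>1 \<beta>\<^sub>2 z"
  shows "rho1 \<mu> (z $ 1) (z $ 2) = root 3 \<beta>\<^sub>1" and "rho2 \<mu> (z $ 1) (z $ 2) = root 3 \<beta>\<^sub>2"
proof -
  define x y P R where "x = z $ 1" and "y = z $ 2" and "P = rho1 \<mu> x y" and "R = rho2 \<mu> x y"
  have P: "P > 0" and R: "R > 0" and "y \<noteq> 0" and zero: "charged_field \<mu> \<beta>\<^sub>1 \<beta>\<^sub>2 z = 0"
    using eq by (auto simp: triangular_equilibrium_def equilibrium_def phase_space_def x_def y_def P_def R_def
        rho1_def rho2_def less_le)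
  define A B where "A = \<beta>\<^sub>1 / P ^ 3" and "B = \<beta>\<^sub>2 / R ^ 3"
  have grad: "potV_x \<mu> \<beta>\<^sub>1 \<beta>\<^sub>2 x y = - ((1 - \<mu>) * A * (x + \<mu>) + \<mu> * B * (x - 1 + \<mu>))"
    "potV_y \<mu> \<beta>\<^sub>1 \<beta>\<^sub>2 x y = - ((1 - \<mu>) * A * y + \<mu> * B * y)"
    using P R by (simp_all add: potV_gradient P_def R_def A_def B_def mult_ac)
  have "z $ 3 = - y" "z $ 4 = x" "potV_x \<mu> \<beta>\<^sub>1 \<beta>\<^sub>2 x y = - x" "potV_y \<mu> \<beta>\<^sub>1 \<beta>\<^sub>2 x y = - y"
    using zero unfolding vec_eq_iff forall_4
    by (simp_all add: charged_field_def x_def y_def eq_neg_iff_add_eq_0 add.commute)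
  then have ex: "(1 - \<mu>) * A * (x + \<mu>) + \<mu> * B * (x - 1 + \<mu>) = x" and "((1 - \<mu>) * A + \<mu> * B) * y = y"
    using grad by (simp_all add: algebra_simps)
  with \<open>y \<noteq> 0\<close> have sum: "(1 - \<mu>) * A + \<mu> * B = 1" by simp
  have "(1 - \<mu>) * A * (x + \<mu>) + \<mu> * B * (x - 1 + \<mu>) = ((1 - \<mu>) * A + \<mu> * B) * x + \<mu> * (1 - \<mu>) * (A - B)"
    by (simp add: algebra_simps)
  with ex sum have "\<mu> * (1 - \<mu>) * (A - B) = 0" by simp
  with assms have "A = B" by simp
  with sum have "A = 1" "B = 1" by (simp_all add: algebra_simps)
  then have "\<beta>\<^sub>1 = P ^ 3" "\<beta>\<^sub>2 = R ^ 3" using P R by (simp_all add: A_def B_def)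
  then show "rho1 \<mu> (z $ 1) (z $ 2) = root 3 \<beta>\<^sub>1" "rho2 \<mu> (z $ 1) (z $ 2) = root 3 \<beta>\<^sub>2"
    using P R by (simp_all add: P_def R_def x_def y_def real_root_power_cancel)
qed

text \<open>Each primary attracts with its mass times the displacement, so the total force is minus the
displacement from the center of mass, which is the origin, and it balances the centrifugal force. This also
holds on the axis, where it makes the limit of the triangular solutions an equilibrium.\<close>

lemma equilibrium_if_distances:
  assumes "\<beta>\<^sub>1 > 0" "\<beta>\<^sub>2 > 0"
    and r: "rho1 \<mu> x y = root 3 \<beta>\<^sub>1" "rho2 \<mu> x y = root 3 \<beta>\<^sub>2"
  shows "equilibrium (charged_field \<mu> \<beta>\<^sub>1 \<beta>\<^sub>2) (phase_space \<mu>) (vector [x, y, - y, x])"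
proof -
  have "potV_x \<mu> \<beta>\<^sub>1 \<beta>\<^sub>2 x y = - x" "potV_y \<mu> \<beta>\<^sub>1 \<beta>\<^sub>2 x y = - y"
    using assms by (simp_all add: potV_gradient) (simp_all add: algebra_simps)
  then show ?thesis
    using assms by (simp add: equilibrium_def phase_space_def charged_field_def vec_eq_iff forall_4)
qed

text \<open>The cosine relation for \<open>\<gamma>\<close> says that \<open>- cos \<gamma>\<close> is the inner product of the unit vectors pointing
from the primaries to the equilibrium. So \<open>sin \<gamma>\<close> is, up to sign, their cross product, which is
\<open>y\<close> over the product of the distances because the primaries are at distance \<open>1\<close>.\<close>

lemma sin_gamma_angle:
  assumes "\<beta>\<^sub>1 > 0" "\<beta>\<^sub>2 > 0" and \<delta>: "\<delta>\<^sub>1 = root 3 \<beta>\<^sub>1" "\<delta>\<^sub>2 = root 3 \<beta>\<^sub>2"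
    and tri: "\<delta>\<^sub>1 + 1 \<ge> \<delta>\<^sub>2" "\<delta>\<^sub>2 + 1 \<ge> \<delta>\<^sub>1" "\<delta>\<^sub>1 + \<delta>\<^sub>2 \<ge> 1"
    and r: "rho1 \<mu> x y = \<delta>\<^sub>1" "rho2 \<mu> x y = \<delta>\<^sub>2"
  shows "(sin (gamma_angle \<delta>\<^sub>1 \<delta>\<^sub>2))\<^sup>2 = y\<^sup>2 / (\<delta>\<^sub>1\<^sup>2 * \<delta>\<^sub>2\<^sup>2)"
proof -
  define C u where "C = cos (gamma_angle \<delta>\<^sub>1 \<delta>\<^sub>2)" and "u = x + \<mu>"
  have pos: "\<delta>\<^sub>1 > 0" "\<delta>\<^sub>2 > 0" using assms by simp_all
  have sq: "\<delta>\<^sub>1\<^sup>2 = u\<^sup>2 + y\<^sup>2" "\<delta>\<^sub>2\<^sup>2 = (u - 1)\<^sup>2 + y\<^sup>2"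
    unfolding r[symmetric] by (simp_all add: rho1_def rho2_def u_def algebra_simps)
  have "2 * (\<delta>\<^sub>1 * \<delta>\<^sub>2 * C) = 1 - \<delta>\<^sub>1\<^sup>2 - \<delta>\<^sub>2\<^sup>2"
    using gamma_angle(2)[OF pos tri] by (simp add: C_def algebra_simps)
  then have "\<delta>\<^sub>1 * \<delta>\<^sub>2 * C = u - u\<^sup>2 - y\<^sup>2"
    unfolding sq by (simp add: power2_eq_square algebra_simps)
  then have "(\<delta>\<^sub>1 * \<delta>\<^sub>2 * C)\<^sup>2 = (u - u\<^sup>2 - y\<^sup>2)\<^sup>2" by simp
  moreover have "(u\<^sup>2 + y\<^sup>2) * ((u - 1)\<^sup>2 + y\<^sup>2) - (u - u\<^sup>2 - y\<^sup>2)\<^sup>2 = y\<^sup>2"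
    by (simp add: power2_eq_square algebra_simps)
  ultimately have "\<delta>\<^sub>1\<^sup>2 * \<delta>\<^sub>2\<^sup>2 * (1 - C\<^sup>2) = y\<^sup>2"
    unfolding sq[symmetric] by (simp add: power_mult_distrib algebra_simps)
  then show ?thesis
    using pos by (simp add: sin_squared_eq C_def nonzero_eq_divide_eq mult.commute)
qed

lemma linearized_eq:
  assumes "(X has_derivative L) (at p)"
  shows "linearized X p = L"
proof -
  have "(X has_derivative linearized X p) (at p)"
    using assms unfolding linearized_def by (metis differentiable_def jacobian_works)
  then show ?thesis using assms by (rule has_derivative_unique)
qed

section \<open>The four regimes\<close>

theorem theorem5p1:
  fixes \<mu> \<beta>\<^sub>1 \<beta>\<^sub>2 \<delta>\<^sub>1 \<delta>\<^sub>2 \<gamma> :: real and z :: "real^4"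
  assumes "0 < \<mu>" and "\<mu> \<le> 1 / 2"
    and "\<beta>\<^sub>1 > 0" and "\<beta>\<^sub>2 > 0" and "(\<beta>\<^sub>1 - 1) * (\<beta>\<^sub>2 - 1) < 1"
    and "\<delta>\<^sub>1 = root 3 \<beta>\<^sub>1" and "\<delta>\<^sub>2 = root 3 \<beta>\<^sub>2"
    and "\<delta>\<^sub>1 + 1 \<ge> \<delta>\<^sub>2" and "\<delta>\<^sub>2 + 1 \<ge> \<delta>\<^sub>1" and "\<delta>\<^sub>1 + \<delta>\<^sub>2 \<ge> 1"
    and "\<gamma> = gamma_angle \<delta>\<^sub>1 \<delta>\<^sub>2"
    and "if \<delta>\<^sub>1 + 1 > \<delta>\<^sub>2 \<and> \<delta>\<^sub>2 + 1 > \<delta>\<^sub>1 \<and> \<delta>\<^sub>1 + \<delta>\<^sub>2 > 1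
         then triangular_equilibrium \<mu> \<beta>\<^sub>1 \<beta>\<^sub>2 z
         else collinear_limit \<mu> \<beta>\<^sub>1 \<beta>\<^sub>2 z"
  shows "(stability_F \<mu> \<gamma> < 0 \<longrightarrow>
            lyapunov_unstable (charged_field \<mu> \<beta>\<^sub>1 \<beta>\<^sub>2) (phase_space \<mu>) z) \<and>
         (stability_F \<mu> \<gamma> = 0 \<longrightarrow>
            linearly_unstable (charged_field \<mu> \<beta>\<^sub>1 \<beta>\<^sub>2) (phase_space \<mu>) z) \<and>
         (0 < stability_F \<mu> \<gamma> \<and> stability_F \<mu> \<gamma> < 1 \<longrightarrow>
            linearly_stable (charged_field \<mu> \<beta>\<^sub>1 \<beta>\<^sub>2) (phase_space \<mu>) z) \<and>
         (stability_F \<mu> \<gamma> = 1 \<longrightarrow>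
            linearly_unstable (charged_field \<mu> \<beta>\<^sub>1 \<beta>\<^sub>2) (phase_space \<mu>) z)"
proof -
  have \<mu>: "0 < \<mu>" "\<mu> < 1" using assms(1,2) by auto
  have \<beta>: "\<beta>\<^sub>1 > 0" "\<beta>\<^sub>2 > 0" by fact+
  have pos: "\<delta>\<^sub>1 > 0" "\<delta>\<^sub>2 > 0" using assms(3,4,6,7) by simp_all
  let ?X = "charged_field \<mu> \<beta>\<^sub>1 \<beta>\<^sub>2" and ?U = "phase_space \<mu>"
  have distances: "rho1 \<mu> (z $ 1) (z $ 2) = root 3 \<beta>\<^sub>1" "rho2 \<mu> (z $ 1) (z $ 2) = root 3 \<beta>\<^sub>2"
    using assms(12) triangular_equilibrium_distances[OF \<mu>]
    by (auto simp: collinear_limit_def split: if_splits)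
  have eq: "equilibrium ?X ?U z"
    using assms(12) equilibrium_if_distances[OF \<beta>, of \<mu> _ 0]
    by (auto simp: collinear_limit_def triangular_equilibrium_def split: if_splits)
  define x y where "x = z $ 1" and "y = z $ 2"
  define a where "a = 3 * ((1 - \<mu>) * (x + \<mu>)\<^sup>2 / \<delta>\<^sub>1\<^sup>2 + \<mu> * (x - 1 + \<mu>)\<^sup>2 / \<delta>\<^sub>2\<^sup>2) - 1"
  define b where "b = 3 * ((1 - \<mu>) * (x + \<mu>) * y / \<delta>\<^sub>1\<^sup>2 + \<mu> * (x - 1 + \<mu>) * y / \<delta>\<^sub>2\<^sup>2)"
  define c where "c = 3 * ((1 - \<mu>) * y\<^sup>2 / \<delta>\<^sub>1\<^sup>2 + \<mu> * y\<^sup>2 / \<delta>\<^sub>2\<^sup>2) - 1"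
  define L where "L = hessian_field a b c"
  have deriv: "(?X has_derivative L) (at z)"
    unfolding L_def
    by (rule charged_field_has_derivative[OF \<beta> distances refl refl refl])
      (simp_all add: a_def b_def c_def x_def y_def assms(6,7))
  have L: "linear L" unfolding L_def by (rule linear_hessian_field)
  define k where "k = 9 * \<mu> * (1 - \<mu>) * (sin \<gamma>)\<^sup>2"
  have F: "stability_F \<mu> \<gamma> = 1 - 4 * k" by (simp add: stability_F_def k_def)
  have sin: "(sin \<gamma>)\<^sup>2 = y\<^sup>2 / (\<delta>\<^sub>1\<^sup>2 * \<delta>\<^sub>2\<^sup>2)"
    unfolding assms(11) using distances assms(6,7)
    by (intro sin_gamma_angle[OF \<beta> assms(6-10), of \<mu> x]) (simp_all add: x_def y_def)
  have sq: "\<delta>\<^sub>1\<^sup>2 = (x + \<mu>)\<^sup>2 + y\<^sup>2" "\<delta>\<^sub>2\<^sup>2 = (x - 1 + \<mu>)\<^sup>2 + y\<^sup>2"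
    unfolding assms(6,7) distances[symmetric] by (simp_all add: rho1_def rho2_def x_def y_def)
  have trace: "a + c = 1"
  proof -
    have "a + c = 3 * ((1 - \<mu>) * (((x + \<mu>)\<^sup>2 + y\<^sup>2) / \<delta>\<^sub>1\<^sup>2) + \<mu> * (((x - 1 + \<mu>)\<^sup>2 + y\<^sup>2) / \<delta>\<^sub>2\<^sup>2)) - 2"
      by (simp add: a_def c_def add_divide_distrib algebra_simps)
    then show ?thesis unfolding sq[symmetric] using pos by simp
  qed
  have det: "(1 + a) * (1 + c) - b\<^sup>2 = k"
  proof -
    have "(1 + a) * (1 + c) - b\<^sup>2 =
        9 * \<mu> * (1 - \<mu>) * ((x + \<mu>) * y - (x - 1 + \<mu>) * y)\<^sup>2 / (\<delta>\<^sub>1\<^sup>2 * \<delta>\<^sub>2\<^sup>2)"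
      using pos by (simp add: a_def b_def c_def field_simps power2_eq_square)
    then show ?thesis by (simp add: k_def sin algebra_simps)
  qed
  note char = hessian_field_characteristic[OF trace det, folded L_def]
  \<comment> \<open>A unit kick in \<open>p\<^sub>y\<close>: the Coriolis term makes the first coordinate of \<open>L (L e)\<close> nonzero, so that
    \<open>L\<close> satisfies no polynomial of degree two.\<close>
  define e :: "real^4" where "e = vector [0, 0, 0, 1]"
  have L1: "L e $ 1 = 0" and L2: "L (L e) $ 1 = 2" and e1: "e $ 1 = 0"
    by (simp_all add: L_def hessian_field_def e_def)
  have "lyapunov_unstable ?X ?U z" if "stability_F \<mu> \<gamma> < 0"
  proof -
    have "k > 1 / 4" using that F by simp
    \<comment> \<open>\<open>\<lambda>^4 + \<lambda>^2 + k = (\<lambda>^2 + \<kappa>)^2 - s^2 \<lambda>^2\<close> with \<open>\<kappa> = sqrt k\<close> and \<open>s^2 = 2 \<kappa> - 1\<close>.\<close>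
    define \<kappa> where "\<kappa> = sqrt k"
    have \<kappa>: "\<kappa>\<^sup>2 = k" "\<kappa> > 1 / 2"
      using \<open>k > 1 / 4\<close> real_sqrt_less_mono[of "1 / 4" k] by (simp_all add: \<kappa>_def real_sqrt_divide)
    define s where "s = sqrt (2 * \<kappa> - 1)"
    have s: "s > 0" "s\<^sup>2 = 2 * \<kappa> - 1" using \<kappa> by (simp_all add: s_def)
    show ?thesis
    proof (rule lyapunov_unstable_if_complex_quadruple[OF open_phase_space _ _ deriv \<open>s > 0\<close>])
      show "z \<in> ?U" "?X z = 0" using eq by (auto simp: equilibrium_def)
      show "s\<^sup>2 < 4 * \<kappa>" using s \<kappa> by simp
      show "L (L (L (L h))) + (2 * \<kappa> - s\<^sup>2) *\<^sub>R L (L h) + \<kappa>\<^sup>2 *\<^sub>R h = 0" for h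
        using char[of h] s \<kappa> by simp
      have "(L (L e) + s *\<^sub>R L e + \<kappa> *\<^sub>R e) $ 1 \<noteq> 0" by (simp add: L1 L2 e1)
      then show "L (L e) + s *\<^sub>R L e + \<kappa> *\<^sub>R e \<noteq> 0" by (metis zero_index)
    qed
  qed
  moreover have "lyapunov_unstable L UNIV 0" if "stability_F \<mu> \<gamma> = 0"
  proof -
    have k: "k = 1 / 4" using that F by simp
    show ?thesis
    proof (rule lyapunov_unstable_if_imaginary_jordan_block[OF L, where a = "1 / 2"])
      fix h
      have "L (L (L (L h) + (1 / 2) *\<^sub>R h)) + (1 / 2) *\<^sub>R (L (L h) + (1 / 2) *\<^sub>R h)
          = L (L (L (L h))) + L (L h) + k *\<^sub>R h"
        by (simp add: k linear_add[OF L] linear_scale[OF L] scaleR_right_distrib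
            scaleR_half_double flip: scaleR_add_left)
      then show "L (L (L (L h) + (1 / 2) *\<^sub>R h)) + (1 / 2) *\<^sub>R (L (L h) + (1 / 2) *\<^sub>R h) = 0"
        using char[of h] by simp
    next
      have "(L (L e) + (1 / 2) *\<^sub>R e) $ 1 \<noteq> 0" by (simp add: L2 e1)
      then show "L (L e) + (1 / 2) *\<^sub>R e \<noteq> 0" by (metis zero_index)
    qed simp_all
  qed
  moreover have "lyapunov_stable L UNIV 0" if "0 < stability_F \<mu> \<gamma>" "stability_F \<mu> \<gamma> < 1"
  proof -
    \<comment> \<open>The roots of \<open>\<lambda>^4 + \<lambda>^2 + k\<close> have \<open>\<lambda>^2 = - (1 \<plusminus> S) / 2\<close>.\<close>
    define S where "S = sqrt (1 - 4 * k)"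
    have S: "0 < S" "S < 1" "S\<^sup>2 = 1 - 4 * k"
      using that F by (auto simp: S_def)
    have ab: "(1 + S) / 2 + (1 - S) / 2 = 1" "(1 + S) / 2 * ((1 - S) / 2) = k"
      using S(3) by (simp_all add: field_simps power2_eq_square)
    show ?thesis
      by (rule lyapunov_stable_if_two_frequencies[OF L, where a = "(1 + S) / 2" and b = "(1 - S) / 2"])
        (use S char in \<open>simp_all only: ab scaleR_one, simp_all\<close>)
  qed
  moreover have "lyapunov_unstable L UNIV 0" if "stability_F \<mu> \<gamma> = 1"
  proof -
    have k: "k = 0" using that F by simp
    \<comment> \<open>Only the collinear limit has \<open>sin \<gamma> = 0\<close>.\<close>
    then have "y = 0" using \<mu> pos by (simp add: k_def sin)
    then have c: "c = - 1" by (simp add: c_def)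
    show ?thesis
    proof (rule lyapunov_unstable_if_zero_jordan_block[OF L, where N = "\<lambda>h. L (L h) + h" and v = e])
      show "linear (\<lambda>h. L (L h) + h)"
        by (simp add: linear_iff linear_add[OF L] linear_scale[OF L] algebra_simps)
      show "L (L (L h)) + L h = L (L (L h) + h)" for h by (simp add: linear_add[OF L])
      show "L (L (L (L h) + h)) = 0" for h using char[of h] by (simp add: k linear_add[OF L])
      have "L (L (L e) + e) $ 2 = - 3"
        by (simp add: L_def hessian_field_def e_def c)
      then show "L (L (L e) + e) \<noteq> 0" by (metis zero_index zero_neq_neg_numeral)
    qed
  qed
  ultimately show ?thesis
    unfolding linearly_unstable_def linearly_stable_def linearized_eq[OF deriv]
    using eq by blast
qed

end
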